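(* Fix an integer $n$ and $\varepsilon\in(1/n,1/30)$. Then every $n$-vertex graph $G=(V,E,w)$ with edge weights in the range $[1,W]$ admits a cut sketch of size $\tilde O(n\varepsilon^{-1}\cdot\log\log W)$ bits with the ``for each'' guarantee. Specifically, for every query $S\subset V$ (equivalently, every $x\in\{0,1\}^n$), the sketch can produce, with high probability, a $(1+O(\varepsilon))$-approximation to $w(S,\bar S)$.
   Context: Graphs are undirected; $w(S,\bar S)$ is the total weight of edges of $G$ with exactly one endpoint in $S$. A cut sketch with the ``for each'' guarantee consists of a randomized map from graphs $G$ on $n$ vertices to bit strings $\mathrm{sk}(G)$, together with an estimation procedure which, given only $\mathrm{sk}(G)$ and a query $S\subset V$, outputs a number $\hat w$; the success probability is required for each fixed $G$ and $S$ separately. A $(1+O(\varepsilon))$-approximation means $(1-K\varepsilon)w(S,\bar S)\le\hat w\le(1+K\varepsilon)w(S,\bar S)$ for an absolute constant $K$. ``With high probability'' means with probability at least $1-1/n^{a}$ for some absolute constant $a\ge1$. $\tilde O(f)$ denotes $f\cdot(\log f)^{O(1)}$, with absolute constants. The factor $\log\log W$ is read as $\max\{1,\log\log W\}$. *)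

theory Defs
  imports "HOL-Probability.Probability"
begin

text \<open>Finite simple undirected weighted graphs on the vertex set \<open>{..<n}\<close>. An edge is a
  two-element set of vertices; values of \<open>weight\<close> outside \<open>edges\<close> are irrelevant.\<close>

record wgraph =
  edges :: "nat set set"
  weight :: "nat set \<Rightarrow> real"

definition wgraphs :: "nat \<Rightarrow> real \<Rightarrow> wgraph set" where
  "wgraphs n W = {G. (\<forall>e\<in>edges G. e \<subseteq> {..<n} \<and> card e = 2 \<and> 1 \<le> weight G e \<and> weight G e \<le> W)}"

definition cut_weight :: "wgraph \<Rightarrow> nat set \<Rightarrow> real" where
  "cut_weight G S = (\<Sum>e | e \<in> edges G \<and> card (e \<inter> S) = 1. weight G e)"

definition approximates :: "real \<Rightarrow> real \<Rightarrow> real \<Rightarrow> bool" where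
  "approximates \<delta> v v' \<longleftrightarrow> (1 - \<delta>) * v \<le> v' \<and> v' \<le> (1 + \<delta>) * v"

text \<open>A sketch is a randomized map \<open>sk\<close> into bit strings (a distribution on bit strings is
  discrete, hence a \<open>pmf\<close>) with an estimator \<open>est\<close> that sees only the bit string and
  the query. The randomness is that of \<open>sk\<close>; the graph and the query are fixed outside the
  probability, which is the ``for each'' guarantee.\<close>

definition for_each_cut_sketch ::
  "nat \<Rightarrow> real \<Rightarrow> real \<Rightarrow> real \<Rightarrow> (wgraph \<Rightarrow> bool list pmf) \<Rightarrow> (bool list \<Rightarrow> nat set \<Rightarrow> real) \<Rightarrow> bool"
where
  "for_each_cut_sketch n W \<delta> p sk est \<longleftrightarrow>
     (\<forall>G\<in>wgraphs n W. \<forall>S. S \<subseteq> {..<n} \<longrightarrow>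
        measure_pmf.prob (sk G) {b. approximates \<delta> (cut_weight G S) (est b S)} \<ge> p)"

text \<open>Size is worst case: it bounds every bit string that occurs with positive probability.\<close>

definition sketch_size_le :: "nat \<Rightarrow> real \<Rightarrow> (wgraph \<Rightarrow> bool list pmf) \<Rightarrow> real \<Rightarrow> bool" where
  "sketch_size_le n W sk B \<longleftrightarrow>
     (\<forall>G\<in>wgraphs n W. \<forall>b\<in>set_pmf (sk G). real (length b) \<le> B)"

text \<open>\<open>n / \<epsilon> * max {1, log log W}\<close>. At \<open>W = 1\<close> the inner logarithm is 0, where
  the library's total \<open>log\<close> returns 0, and the maximum is 1.\<close>

definition size_param :: "nat \<Rightarrow> real \<Rightarrow> real \<Rightarrow> real" where
  "size_param n \<epsilon> W = real n / \<epsilon> * max 1 (log 2 (log 2 W))"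

text \<open>Soft-O of \<open>f\<close> is \<open>f * (log f)^c\<close> for an absolute constant \<open>c\<close>. Neither a leading constant
  nor the base of the logarithms matters where \<open>f\<close> is bounded away from 2, since such factors are
  absorbed by \<open>c\<close>; for \<open>1/n < \<epsilon> < 1/30\<close> one has \<open>size_param n \<epsilon> W > 900\<close>.\<close>

definition soft_O :: "nat \<Rightarrow> real \<Rightarrow> real" where
  "soft_O c f = f * (log 2 f) ^ c"

end

theory Submission
  imports Defs
begin

text \<open>Sort the edges by weight. A cut is determined up to a factor \<open>1 + 1/n\<close> by the edges within a
  factor \<open>n\<^sup>3\<close> of its heaviest edge, whose weight is about \<open>2 ^ M\<close>; heavier edges can be contracted
  and lighter ones dropped. An edge matters for \<open>O(log n)\<close> levels \<open>M\<close> before it is contracted, so the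
  contracted graphs together have \<open>O(n log n)\<close> non-isolated vertices.

  At one level, group the merged edges into classes of weight in \<open>[\<beta>, 2\<beta>)\<close> and cut each class graph
  along cuts sparser than \<open>\<tau> = \<gamma> / \<epsilon>\<close>, for \<open>\<gamma> = \<beta> 2 ^ j\<close>; the weight lost is \<open>O(\<tau> n log n)\<close>. For a query
  \<open>S\<close> let \<open>T\<close> be the union of the smaller sides of \<open>S\<close> in the parts, so that the cut has weight at least
  \<open>\<tau> |T|\<close> by expansion. Take the least \<open>j\<close> with \<open>|T| \<le> 1/\<epsilon>\<close>. The weight cut inside the parts is the sum
  of the exactly stored degrees over \<open>T\<close>, minus the weight of the pairs within \<open>T\<close>. As \<open>T\<close> is small, this
  correction is small, and sampling the pair \<open>(x, y)\<close> with probability proportional to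
  \<open>g x y / (\<epsilon> deg x)\<close>, which costs only \<open>O(1/\<epsilon>)\<close> samples per vertex, estimates it with standard deviation
  \<open>O(\<epsilon>)\<close> times the cut. Minimality of \<open>j\<close> gives a cut of weight at least \<open>\<gamma> / (2 \<epsilon>\<^sup>2)\<close>, so edges between
  parts may be sampled at rate \<open>1/\<gamma>\<close>. Bernstein's inequality then bounds the failure probability.\<close>

section \<open>Encoding sparse maps\<close>

text \<open>Size is settled by counting: an injection into the bit strings of length
  \<open>N\<close> exists as soon as \<open>X\<close> has at most \<open>2 ^ N\<close> elements, so
  no concrete bit layout has to be designed.\<close>

lemma ex_fixed_length_encoding:
  assumes "finite X" "card X \<le> 2 ^ N"
  obtains enc :: "'a \<Rightarrow> bool list" and dec :: "bool list \<Rightarrow> 'a"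
  where "\<And>x. x \<in> X \<Longrightarrow> length (enc x) = N" "\<And>x. x \<in> X \<Longrightarrow> dec (enc x) = x"
proof -
  let ?B = "{bs :: bool list. set bs \<subseteq> UNIV \<and> length bs = N}"
  have "card ?B = 2 ^ N"
    by (subst card_lists_length_eq) auto
  moreover have "finite ?B"
    by (rule finite_lists_length_eq) auto
  ultimately obtain f where f: "f ` X \<subseteq> ?B" "inj_on f X"
    using card_le_inj[of X ?B] assms by auto
  show ?thesis
    by (rule that[of f "the_inv_into X f"]) (use f in \<open>auto simp: the_inv_into_f_f\<close>)
qed

lemma sum_power_le_Suc_power: "(\<Sum>i\<le>m. c ^ i) \<le> (Suc c) ^ m" for c m :: nat
proof (induction m)
  case (Suc m)
  have "c ^ Suc m \<le> c * Suc c ^ m"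
    by (simp add: mult_left_mono power_mono)
  with Suc have "(\<Sum>i\<le>Suc m. c ^ i) \<le> Suc c ^ m + c * Suc c ^ m"
    unfolding sum.atMost_Suc by (rule add_mono)
  then show ?case by simp
qed simp

definition sparse_maps :: "'a set \<Rightarrow> 'b set \<Rightarrow> nat \<Rightarrow> ('a \<Rightarrow> 'b option) set" where
  "sparse_maps A B m = {F. dom F \<subseteq> A \<and> ran F \<subseteq> B \<and> card (dom F) \<le> m}"

text \<open>A map with at most \<open>m\<close> keys is \<open>map_of\<close> of an association list
  of length at most \<open>m\<close>, so it is enough to count lists over
  \<open>A \<times> B\<close>.\<close>

lemma sparse_maps_finite_card:
  assumes "finite A" "finite B"
  shows "finite (sparse_maps A B m)" "card (sparse_maps A B m) \<le> Suc (card A * card B) ^ m"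
proof -
  let ?L = "{xs. set xs \<subseteq> A \<times> B \<and> length xs \<le> m}"
  have fin: "finite ?L"
    using assms by (intro finite_lists_length_le) auto
  have sub: "sparse_maps A B m \<subseteq> map_of ` ?L"
  proof
    fix F assume F: "F \<in> sparse_maps A B m"
    then have "finite (dom F)"
      using assms finite_subset by (auto simp: sparse_maps_def)
    then obtain ks where ks: "set ks = dom F" "distinct ks"
      using finite_distinct_list by blast
    let ?xs = "map (\<lambda>k. (k, the (F k))) ks"
    have "?xs \<in> ?L"
      using F ks distinct_card[of ks] by (auto simp: sparse_maps_def ran_def dom_def)
    moreover have "F = map_of ?xs"
      using map_of_map_keys[of ks F] ks by simp
    ultimately show "F \<in> map_of ` ?L" by blast
  qed
  show "finite (sparse_maps A B m)"
    using sub fin finite_surj by blast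
  have "card (sparse_maps A B m) \<le> card ?L"
    using surj_card_le[OF fin sub] .
  also have "\<dots> = (\<Sum>i\<le>m. (card A * card B) ^ i)"
    using assms by (subst card_lists_length_le) (auto simp: card_cartesian_product)
  also have "\<dots> \<le> Suc (card A * card B) ^ m"
    by (rule sum_power_le_Suc_power)
  finally show "card (sparse_maps A B m) \<le> Suc (card A * card B) ^ m" .
qed

section \<open>Tail bounds for independent Bernoulli samples\<close>

definition bernoulli_family :: "'i set \<Rightarrow> ('i \<Rightarrow> real) \<Rightarrow> ('i \<Rightarrow> bool) pmf" where
  "bernoulli_family I p = Pi_pmf I False (\<lambda>i. bernoulli_pmf (p i))"

lemma finite_set_bernoulli_family: "finite I \<Longrightarrow> finite (set_pmf (bernoulli_family I p))"
  unfolding bernoulli_family_def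
  by (rule finite_subset[OF set_Pi_pmf_subset']) (auto intro!: finite_PiE_dflt)

lemma bernoulli_family_expectation_exp:
  fixes c :: "'i \<Rightarrow> real"
  assumes "finite I" "\<And>i. i \<in> I \<Longrightarrow> 0 \<le> p i \<and> p i \<le> 1"
  shows "measure_pmf.expectation (bernoulli_family I p) (\<lambda>\<omega>. exp (\<Sum>i\<in>I. c i * of_bool (\<omega> i)))
    = (\<Prod>i\<in>I. 1 + p i * (exp (c i) - 1))"
proof -
  have "measure_pmf.expectation (bernoulli_family I p) (\<lambda>\<omega>. exp (\<Sum>i\<in>I. c i * of_bool (\<omega> i)))
    = measure_pmf.expectation (Pi_pmf I False (\<lambda>i. bernoulli_pmf (p i)))
        (\<lambda>\<omega>. \<Prod>i\<in>I. exp (c i * of_bool (\<omega> i)))"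
    unfolding bernoulli_family_def exp_sum[OF assms(1)] ..
  also have "\<dots> = (\<Prod>i\<in>I. measure_pmf.expectation (bernoulli_pmf (p i)) (\<lambda>v. exp (c i * of_bool v)))"
    by (rule expectation_prod_Pi_pmf) (auto intro!: integrable_measure_pmf_finite assms)
  also have "\<dots> = (\<Prod>i\<in>I. 1 + p i * (exp (c i) - 1))"
    using assms by (intro prod.cong) (auto simp: algebra_simps)
  finally show ?thesis .
qed

lemma pmf_exp_Markov:
  fixes X :: "'a \<Rightarrow> real"
  assumes "finite (set_pmf M)"
  shows "measure_pmf.prob M {\<omega>. t \<le> X \<omega>} \<le> exp (- t) * measure_pmf.expectation M (\<lambda>\<omega>. exp (X \<omega>))"
proof -
  have "measure_pmf.prob M {\<omega> \<in> space M. exp t \<le> exp (X \<omega>)}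
      \<le> measure_pmf.expectation M (\<lambda>\<omega>. exp (X \<omega>)) / exp t"
    by (rule integral_Markov_inequality_measure[where A = UNIV, simplified])
      (auto intro!: integrable_measure_pmf_finite assms)
  then show ?thesis by (simp add: exp_minus field_simps)
qed

lemma exp_le_quadratic:
  fixes x :: real
  assumes "\<bar>x\<bar> \<le> 1"
  shows "exp x \<le> 1 + x + x\<^sup>2"
proof (cases "x \<ge> 0")
  case True
  then show ?thesis using exp_bound[of x] assms by simp
next
  case False
  \<comment> \<open>The product is \<open>1 - x ^ 3\<close>, and \<open>x\<close> is negative
    here.\<close>
  have "1 \<le> (1 + x + x\<^sup>2) * (1 - x)"
    using False by (simp add: algebra_simps power2_eq_square power3_eq_cube mult_nonneg_nonpos2
        mult_nonneg_nonpos zero_le_mult_iff mult_le_0_iff)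
  also have "\<dots> \<le> (1 + x + x\<^sup>2) * exp (- x)"
    using exp_ge_add_one_self[of "-x"] assms
    by (intro mult_left_mono) (auto simp: abs_le_iff)
  finally show ?thesis by (simp add: exp_minus field_simps)
qed

text \<open>Since \<^term>\<open>exp x \<le> 1 + x + x\<^sup>2\<close> is only available for \<^term>\<open>\<bar>x\<bar> \<le> 1\<close>, the parameter \<open>lam\<close> has
  to be small relative to \<open>p i / a i\<close>; the terms with \<^term>\<open>p i = 1\<close> are deterministic.\<close>

lemma bernstein_upper_tail:
  fixes a p :: "'i \<Rightarrow> real"
  assumes I: "finite I" and p: "\<And>i. i \<in> I \<Longrightarrow> 0 < p i \<and> p i \<le> 1"
    and lam: "\<And>i. i \<in> I \<Longrightarrow> p i < 1 \<Longrightarrow> lam * \<bar>a i\<bar> \<le> p i" "0 < lam"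
  shows "measure_pmf.prob (bernoulli_family I p)
      {\<omega>. t \<le> (\<Sum>i\<in>I. a i * (of_bool (\<omega> i) / p i - 1))}
    \<le> exp (- lam * t + lam\<^sup>2 * (\<Sum>i\<in>{i\<in>I. p i < 1}. (a i)\<^sup>2 / p i))"
proof -
  let ?M = "bernoulli_family I p"
  define x where "x i = lam * a i / p i" for i
  \<comment> \<open>The mean \<open>lam * a i\<close> of each term moves to the threshold. What
    remains is a weighted sum of independent indicators, whose exponential factorises.\<close>
  have "measure_pmf.prob ?M {\<omega>. t \<le> (\<Sum>i\<in>I. a i * (of_bool (\<omega> i) / p i - 1))}
      = measure_pmf.prob ?M {\<omega>. lam * t + (\<Sum>i\<in>I. lam * a i) \<le> (\<Sum>i\<in>I. x i * of_bool (\<omega> i))}"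
  proof (rule arg_cong[where f = "measure_pmf.prob ?M"], rule Collect_cong)
    fix \<omega>
    have "lam * (\<Sum>i\<in>I. a i * (of_bool (\<omega> i) / p i - 1))
        = (\<Sum>i\<in>I. x i * of_bool (\<omega> i)) - (\<Sum>i\<in>I. lam * a i)"
      by (simp add: sum_distrib_left x_def flip: sum_subtractf) (simp add: algebra_simps)
    then show "t \<le> (\<Sum>i\<in>I. a i * (of_bool (\<omega> i) / p i - 1)) \<longleftrightarrow>
        lam * t + (\<Sum>i\<in>I. lam * a i) \<le> (\<Sum>i\<in>I. x i * of_bool (\<omega> i))"
      using lam(2) by (smt (verit) mult_le_cancel_left_pos)
  qed
  also have "\<dots> \<le> exp (- (lam * t + (\<Sum>i\<in>I. lam * a i))) *
      measure_pmf.expectation ?M (\<lambda>\<omega>. exp (\<Sum>i\<in>I. x i * of_bool (\<omega> i)))"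
    by (rule pmf_exp_Markov) (rule finite_set_bernoulli_family[OF I])
  also have "measure_pmf.expectation ?M (\<lambda>\<omega>. exp (\<Sum>i\<in>I. x i * of_bool (\<omega> i)))
      = (\<Prod>i\<in>I. 1 + p i * (exp (x i) - 1))"
    using p by (intro bernoulli_family_expectation_exp I) (auto simp: less_imp_le)
  also have "\<dots> \<le> (\<Prod>i\<in>I. exp (lam * a i + lam\<^sup>2 * (if p i < 1 then (a i)\<^sup>2 / p i else 0)))"
  proof (rule prod_mono, rule conjI)
    fix i assume i: "i \<in> I"
    note pi = p[OF i]
    have "0 \<le> (1 - p i) + p i * exp (x i)" using pi by simp
    then show "0 \<le> 1 + p i * (exp (x i) - 1)" by (simp add: algebra_simps)
    show "1 + p i * (exp (x i) - 1) \<le> exp (lam * a i + lam\<^sup>2 * (if p i < 1 then (a i)\<^sup>2 / p i else 0))"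
    proof (cases "p i < 1")
      case True
      have "\<bar>x i\<bar> \<le> 1"
        using lam(1)[OF i True] lam(2) pi by (simp add: x_def abs_mult)
      then have "p i * (exp (x i) - 1) \<le> p i * (x i + (x i)\<^sup>2)"
        using exp_le_quadratic[of "x i"] pi by (intro mult_left_mono) auto
      also have "\<dots> = lam * a i + lam\<^sup>2 * ((a i)\<^sup>2 / p i)"
        using pi by (simp add: x_def field_simps power2_eq_square)
      finally have "1 + p i * (exp (x i) - 1) \<le> 1 + (lam * a i + lam\<^sup>2 * ((a i)\<^sup>2 / p i))" by simp
      also have "\<dots> \<le> exp (lam * a i + lam\<^sup>2 * ((a i)\<^sup>2 / p i))"
        by (rule exp_ge_add_one_self)
      finally show ?thesis using True by simp
    next
      case False
      then have "p i = 1" using pi by simp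
      then show ?thesis by (simp add: x_def)
    qed
  qed
  also have "\<dots> = exp ((\<Sum>i\<in>I. lam * a i) + lam\<^sup>2 * (\<Sum>i\<in>{i\<in>I. p i < 1}. (a i)\<^sup>2 / p i))"
    using I by (simp add: sum.distrib sum_distrib_left flip: exp_sum) 
      (rule sum.mono_neutral_cong_right, auto)
  finally show ?thesis
    by (simp flip: exp_add)
qed

text \<open>Union bound over the upper tails for \<open>a\<close> and \<open>- a\<close>. The
  variance enters only through an upper bound \<open>v\<close>, which is what the later estimates
  provide.\<close>

lemma bernstein_two_sided:
  fixes a p :: "'i \<Rightarrow> real"
  assumes I: "finite I" and p: "\<And>i. i \<in> I \<Longrightarrow> 0 < p i \<and> p i \<le> 1"
    and lam: "\<And>i. i \<in> I \<Longrightarrow> p i < 1 \<Longrightarrow> lam * \<bar>a i\<bar> \<le> p i" "0 < lam"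
    and v: "(\<Sum>i\<in>{i\<in>I. p i < 1}. (a i)\<^sup>2 / p i) \<le> v"
  shows "measure_pmf.prob (bernoulli_family I p)
      {\<omega>. t \<le> \<bar>\<Sum>i\<in>I. a i * (of_bool (\<omega> i) / p i - 1)\<bar>} \<le> 2 * exp (- lam * t + lam\<^sup>2 * v)"
proof -
  let ?M = "bernoulli_family I p"
  let ?X = "\<lambda>\<omega>. \<Sum>i\<in>I. a i * (of_bool (\<omega> i) / p i - 1)"
  have "{\<omega>. t \<le> \<bar>?X \<omega>\<bar>} \<subseteq> {\<omega>. t \<le> ?X \<omega>} \<union> {\<omega>. t \<le> - ?X \<omega>}" by auto
  then have "measure_pmf.prob ?M {\<omega>. t \<le> \<bar>?X \<omega>\<bar>}
      \<le> measure_pmf.prob ?M ({\<omega>. t \<le> ?X \<omega>} \<union> {\<omega>. t \<le> - ?X \<omega>})"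
    by (intro measure_pmf.finite_measure_mono) auto
  also have "\<dots> \<le> measure_pmf.prob ?M {\<omega>. t \<le> ?X \<omega>} + measure_pmf.prob ?M {\<omega>. t \<le> - ?X \<omega>}"
    by (intro measure_Un_le) auto
  also have "measure_pmf.prob ?M {\<omega>. t \<le> ?X \<omega>}
      \<le> exp (- lam * t + lam\<^sup>2 * (\<Sum>i\<in>{i\<in>I. p i < 1}. (a i)\<^sup>2 / p i))"
    by (rule bernstein_upper_tail) (use I p lam in auto)
  also have "measure_pmf.prob ?M {\<omega>. t \<le> - ?X \<omega>}
      \<le> exp (- lam * t + lam\<^sup>2 * (\<Sum>i\<in>{i\<in>I. p i < 1}. (a i)\<^sup>2 / p i))"
    using bernstein_upper_tail[of I p lam "\<lambda>i. - a i" t] I p lam by (simp add: sum_negf)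
  finally have "measure_pmf.prob ?M {\<omega>. t \<le> \<bar>?X \<omega>\<bar>}
      \<le> 2 * exp (- lam * t + lam\<^sup>2 * (\<Sum>i\<in>{i\<in>I. p i < 1}. (a i)\<^sup>2 / p i))" by simp
  also have "\<dots> \<le> 2 * exp (- lam * t + lam\<^sup>2 * v)"
    using v by (simp add: mult_left_mono)
  finally show ?thesis .
qed

text \<open>Exponential moment at \<open>ln 2\<close>, where each factor is \<open>1 + p i\<close>
  and hence at most \<open>exp (p i)\<close>. The constant 3 works because
  \<open>3 * ln 2 \<ge> 2\<close>. This controls the number of samples that have to be
  stored.\<close>

lemma bernoulli_count_tail:
  fixes p :: "'i \<Rightarrow> real"
  assumes I: "finite I" and p: "\<And>i. i \<in> I \<Longrightarrow> 0 \<le> p i \<and> p i \<le> 1" and Z: "(\<Sum>i\<in>I. p i) \<le> Z"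
  shows "measure_pmf.prob (bernoulli_family I p) {\<omega>. 3 * Z \<le> card {i \<in> I. \<omega> i}} \<le> exp (- Z)"
proof -
  let ?M = "bernoulli_family I p"
  have "0 \<le> (\<Sum>i\<in>I. p i)"
    using p by (intro sum_nonneg) auto
  then have "0 \<le> Z" using Z by simp
  have "measure_pmf.prob ?M {\<omega>. 3 * Z \<le> card {i \<in> I. \<omega> i}}
      = measure_pmf.prob ?M {\<omega>. ln 2 * (3 * Z) \<le> (\<Sum>i\<in>I. ln 2 * of_bool (\<omega> i))}"
    using I by (simp flip: sum_distrib_left add: Int_def)
  also have "\<dots> \<le> exp (- (ln 2 * (3 * Z))) *
      measure_pmf.expectation ?M (\<lambda>\<omega>. exp (\<Sum>i\<in>I. ln 2 * of_bool (\<omega> i)))"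
    by (rule pmf_exp_Markov) (rule finite_set_bernoulli_family[OF I])
  also have "measure_pmf.expectation ?M (\<lambda>\<omega>. exp (\<Sum>i\<in>I. ln 2 * of_bool (\<omega> i)))
      = (\<Prod>i\<in>I. 1 + p i * (exp (ln 2) - 1))"
    by (rule bernoulli_family_expectation_exp[OF I p])
  also have "\<dots> \<le> (\<Prod>i\<in>I. exp (p i))"
    using p by (intro prod_mono) auto
  also have "\<dots> = exp (\<Sum>i\<in>I. p i)"
    using I by (simp add: exp_sum)
  also have "\<dots> \<le> exp Z" using Z by simp
  finally have "measure_pmf.prob ?M {\<omega>. 3 * Z \<le> card {i \<in> I. \<omega> i}} \<le> exp (- (ln 2 * (3 * Z)) + Z)"
    by (simp only: exp_add mult_left_mono exp_ge_zero)
  also have "\<dots> \<le> exp (- Z)"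
  proof -
    have "(2/3 :: real) * Z \<le> ln 2 * Z"
      using ln2_ge_two_thirds \<open>0 \<le> Z\<close> by (intro mult_right_mono) auto
    then show ?thesis by simp
  qed
  finally show ?thesis .
qed

section \<open>Decomposition along sparse cuts\<close>

text \<open>The smaller share gains one bit: \<open>2 * a \<le> a + b\<close> gives
  \<open>log 2 a + 1 \<le> log 2 (a + b)\<close>. The extra \<open>a\<close> pays for the cut made
  in one step of the decomposition.\<close>

lemma entropy_split:
  fixes a b :: real
  assumes "1 \<le> a" "a \<le> b"
  shows "a * log 2 a + b * log 2 b + a \<le> (a + b) * log 2 (a + b)"
proof -
  have "a * log 2 a + a = a * log 2 (2 * a)"
    using assms by (simp add: log_mult distrib_left)
  also have "\<dots> \<le> a * log 2 (a + b)"
    using assms by (intro mult_left_mono) auto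
  finally have "a * log 2 a + a \<le> a * log 2 (a + b)" .
  moreover have "b * log 2 b \<le> b * log 2 (a + b)"
    using assms by (intro mult_left_mono) auto
  ultimately show ?thesis by (simp add: distrib_right)
qed

text \<open>The weight lost to a cut with smaller side \<open>T\<close> is charged to the vertices of \<open>T\<close>, and each
  vertex is charged at most \<open>log 2 (card V)\<close> times because its lab halves each time.\<close>

lemma sparse_cut_decomposition:
  fixes w :: "'a \<Rightarrow> 'a \<Rightarrow> real" and \<tau> :: real
  assumes "finite V" and sym: "\<And>x y. w x y = w y x" and \<tau>: "0 \<le> \<tau>"
  shows "\<exists>lab. (\<forall>x\<in>V. lab x \<in> V) \<and>
    (\<forall>c T. T \<subseteq> {x \<in> V. lab x = c} \<longrightarrow> 2 * card T \<le> card {x \<in> V. lab x = c} \<longrightarrow>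
      \<tau> * card T \<le> (\<Sum>x\<in>T. \<Sum>y\<in>{x \<in> V. lab x = c} - T. w x y)) \<and>
    (\<Sum>x\<in>V. \<Sum>y\<in>{y \<in> V. lab y \<noteq> lab x}. w x y) \<le> 2 * \<tau> * (card V * log 2 (card V))"
  using \<open>finite V\<close>
proof (induction V rule: finite_psubset_induct)
  case (psubset V)
  show ?case
  proof (cases "\<exists>T. T \<subseteq> V \<and> 2 * card T \<le> card V \<and> (\<Sum>x\<in>T. \<Sum>y\<in>V - T. w x y) < \<tau> * card T")
    case False
    show ?thesis
    proof (cases "V = {}")
      case nonempty: False
      \<comment> \<open>Without a sparse cut the whole of \<open>V\<close> is a single part, named
        by one of its vertices.\<close>
      then obtain v where v: "v \<in> V" by blast
      have "0 \<le> log 2 (card V)"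
        using nonempty psubset(1) by (simp add: Suc_leI card_gt_0_iff)
      moreover have "\<tau> * card T \<le> (\<Sum>x\<in>T. \<Sum>y\<in>V - T. w x y)" if "T \<subseteq> V" "2 * card T \<le> card V" for T
        using False that by force
      moreover have "{x \<in> V. v = c} = (if v = c then V else {})" for c
        by auto
      ultimately show ?thesis
        using v \<tau> by (intro exI[of _ "\<lambda>_. v"]) auto
    qed auto
  next
    case True
    then obtain T where T: "T \<subseteq> V" "2 * card T \<le> card V"
        and small: "(\<Sum>x\<in>T. \<Sum>y\<in>V - T. w x y) < \<tau> * card T" by blast
    let ?U = "V - T"
    have fin: "finite T" "finite ?U" using T(1) psubset(1) finite_subset by auto
    have "T \<noteq> {}" using small by auto
    then have cT: "1 \<le> card T" using fin by (simp add: Suc_leI card_gt_0_iff)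
    have cV: "card V = card T + card ?U"
      using fin T(1) psubset(1) by (simp add: card_Diff_subset card_mono)
    have "T \<noteq> V" using T(2) cT by auto
    then have "T \<subset> V" using T(1) by blast
    have "?U \<subset> V" using T(1) \<open>T \<noteq> {}\<close> by auto
    from psubset.IH[OF \<open>T \<subset> V\<close>] obtain f where f: "\<forall>x\<in>T. f x \<in> T"
      "\<forall>c A. A \<subseteq> {x \<in> T. f x = c} \<longrightarrow> 2 * card A \<le> card {x \<in> T. f x = c} \<longrightarrow>
        \<tau> * card A \<le> (\<Sum>x\<in>A. \<Sum>y\<in>{x \<in> T. f x = c} - A. w x y)"
      "(\<Sum>x\<in>T. \<Sum>y\<in>{y \<in> T. f y \<noteq> f x}. w x y) \<le> 2 * \<tau> * (card T * log 2 (card T))"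
      by (elim exE conjE) (rule that)
    from psubset.IH[OF \<open>?U \<subset> V\<close>] obtain g where g: "\<forall>x\<in>?U. g x \<in> ?U"
      "\<forall>c A. A \<subseteq> {x \<in> ?U. g x = c} \<longrightarrow> 2 * card A \<le> card {x \<in> ?U. g x = c} \<longrightarrow>
        \<tau> * card A \<le> (\<Sum>x\<in>A. \<Sum>y\<in>{x \<in> ?U. g x = c} - A. w x y)"
      "(\<Sum>x\<in>?U. \<Sum>y\<in>{y \<in> ?U. g y \<noteq> g x}. w x y) \<le> 2 * \<tau> * (card ?U * log 2 (card ?U))"
      by (elim exE conjE) (rule that)
    \<comment> \<open>The labels of the two recursive calls lie in \<open>T\<close> and in
      \<open>V - T\<close>, so parts from different sides never share a label.\<close>
    define h where "h x = (if x \<in> T then f x else g x)" for x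
    have parts: "{x \<in> V. h x = c} = (if c \<in> T then {x \<in> T. f x = c} else {x \<in> ?U. g x = c})" for c
      using f(1) g(1) T(1) by (auto simp: h_def) (metis Diff_iff)+
    have crossT: "(\<Sum>y\<in>{y \<in> V. h y \<noteq> h x}. w x y)
        = (\<Sum>y\<in>{y \<in> T. f y \<noteq> f x}. w x y) + (\<Sum>y\<in>?U. w x y)" if "x \<in> T" for x
    proof -
      have "{y \<in> V. h y \<noteq> h x} = {y \<in> T. f y \<noteq> f x} \<union> ?U"
        using that f(1) g(1) T(1) by (auto simp: h_def) (metis Diff_iff)+
      then show ?thesis using fin by (simp, subst sum.union_disjoint) auto
    qed
    have crossU: "(\<Sum>y\<in>{y \<in> V. h y \<noteq> h x}. w x y)
        = (\<Sum>y\<in>{y \<in> ?U. g y \<noteq> g x}. w x y) + (\<Sum>y\<in>T. w x y)" if "x \<in> ?U" for x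
    proof -
      have "{y \<in> V. h y \<noteq> h x} = {y \<in> ?U. g y \<noteq> g x} \<union> T"
        using that f(1) g(1) T(1) by (auto simp: h_def)
      then show ?thesis using fin by (simp, subst sum.union_disjoint) auto
    qed
    have swap: "(\<Sum>x\<in>?U. \<Sum>y\<in>T. w x y) = (\<Sum>x\<in>T. \<Sum>y\<in>?U. w x y)"
      by (subst sum.swap) (simp add: sym)
    have sT: "(\<Sum>x\<in>T. \<Sum>y\<in>{y \<in> V. h y \<noteq> h x}. w x y)
        = (\<Sum>x\<in>T. \<Sum>y\<in>{y \<in> T. f y \<noteq> f x}. w x y) + (\<Sum>x\<in>T. \<Sum>y\<in>?U. w x y)"
      unfolding sum.distrib[symmetric] by (rule sum.cong[OF refl crossT])
    have sU: "(\<Sum>x\<in>?U. \<Sum>y\<in>{y \<in> V. h y \<noteq> h x}. w x y)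
        = (\<Sum>x\<in>?U. \<Sum>y\<in>{y \<in> ?U. g y \<noteq> g x}. w x y) + (\<Sum>x\<in>?U. \<Sum>y\<in>T. w x y)"
      unfolding sum.distrib[symmetric] by (rule sum.cong[OF refl crossU])
    have "(\<Sum>x\<in>V. \<Sum>y\<in>{y \<in> V. h y \<noteq> h x}. w x y)
        = (\<Sum>x\<in>T. \<Sum>y\<in>{y \<in> V. h y \<noteq> h x}. w x y) + (\<Sum>x\<in>?U. \<Sum>y\<in>{y \<in> V. h y \<noteq> h x}. w x y)"
      by (subst sum.subset_diff[OF T(1) psubset(1)]) (rule add.commute)
    \<comment> \<open>The double sum runs over ordered pairs, so the weight between \<open>T\<close>
      and its complement appears twice; this is the 2 in front of \<tau>.\<close>
    also have "\<dots> = (\<Sum>x\<in>T. \<Sum>y\<in>{y \<in> T. f y \<noteq> f x}. w x y) + (\<Sum>x\<in>?U. \<Sum>y\<in>{y \<in> ?U. g y \<noteq> g x}. w x y)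
        + 2 * (\<Sum>x\<in>T. \<Sum>y\<in>?U. w x y)"
      unfolding sT sU swap by simp
    also have "\<dots> \<le> 2 * \<tau> * (card T * log 2 (card T)) + 2 * \<tau> * (card ?U * log 2 (card ?U)) + 2 * (\<tau> * card T)"
      using f(3) g(3) small by linarith
    also have "\<dots> = 2 * \<tau> * (card T * log 2 (card T) + card ?U * log 2 (card ?U) + card T)"
      by (simp add: algebra_simps)
    also have "\<dots> \<le> 2 * \<tau> * (card V * log 2 (card V))"
      using entropy_split[of "card T" "card ?U"] cT cV T(2) \<tau> by (intro mult_left_mono) auto
    finally have bound: "(\<Sum>x\<in>V. \<Sum>y\<in>{y \<in> V. h y \<noteq> h x}. w x y) \<le> 2 * \<tau> * (card V * log 2 (card V))" .
    show ?thesis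
    proof (intro exI[of _ h] conjI)
      show "\<forall>x\<in>V. h x \<in> V" using f(1) g(1) T(1) by (auto simp: h_def)
      show "\<forall>c A. A \<subseteq> {x \<in> V. h x = c} \<longrightarrow> 2 * card A \<le> card {x \<in> V. h x = c} \<longrightarrow>
        \<tau> * card A \<le> (\<Sum>x\<in>A. \<Sum>y\<in>{x \<in> V. h x = c} - A. w x y)"
        unfolding parts using f(2) g(2) by simp
    qed (rule bound)
  qed
qed

section \<open>Estimating the cut of a graph with nearly uniform weights\<close>

text \<open>The test depends only on the part of \<open>x\<close>, so in each part the set agrees
  with \<open>S\<close> or with its complement; a tie goes to \<open>S\<close>.\<close>

definition smaller_sides :: "nat set \<Rightarrow> (nat \<Rightarrow> nat) \<Rightarrow> nat set \<Rightarrow> nat set" where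
  "smaller_sides V lab S = {x \<in> V.
     if 2 * card {y \<in> V. lab y = lab x \<and> y \<in> S} \<le> card {y \<in> V. lab y = lab x} then x \<in> S else x \<notin> S}"

text \<open>Signs that correct the degree sum over \<open>T\<close>. That sum counts the pairs of
  \<open>T\<close> within one part in excess, and it misses the pairs between different parts, which
  are taken once, directed out of \<open>S\<close>.\<close>

definition pair_sign :: "(nat \<Rightarrow> nat) \<Rightarrow> nat set \<Rightarrow> nat set \<Rightarrow> nat \<Rightarrow> nat \<Rightarrow> real" where
  "pair_sign lab T S x y =
     (if lab x = lab y then (if x \<in> T \<and> y \<in> T then - 1 else 0) else if x \<in> S \<and> y \<notin> S then 1 else 0)"

text \<open>The decoder can recompute this for a sampled pair, since \<open>same\<close>,
  \<open>d\<close> and \<open>g\<close> are read from the table. \<open>l\<close> is the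
  oversampling factor. Inside a part the rate is normalised by the degree \<open>d\<close> of the
  first vertex, so a vertex costs at most \<open>l / \<epsilon>\<close> samples in
  expectation.\<close>

definition sample_prob :: "real \<Rightarrow> real \<Rightarrow> real \<Rightarrow> bool \<Rightarrow> real \<Rightarrow> real \<Rightarrow> real" where
  "sample_prob l \<epsilon> \<gamma> same d g = min 1 (l * g * (if same then 1 / (\<epsilon> * d) else 1 / \<gamma>))"

text \<open>Each stored weight is divided by its sampling probability, which makes the estimate
  unbiased when pairs are kept with that probability. A pair that was not sampled has
  \<open>h x y = 0\<close> and contributes \<open>0 / 0 = 0\<close>.\<close>

definition layer_est ::
  "real \<Rightarrow> real \<Rightarrow> real \<Rightarrow> nat set \<Rightarrow> (nat \<Rightarrow> nat) \<Rightarrow> (nat \<Rightarrow> real) \<Rightarrow> (nat \<Rightarrow> nat \<Rightarrow> real) \<Rightarrow> nat set \<Rightarrow> real"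
where
  "layer_est l \<epsilon> \<gamma> V lab d h S = (let T = smaller_sides V lab S in
     (\<Sum>x\<in>T. d x) + (\<Sum>x\<in>V. \<Sum>y\<in>V. pair_sign lab T S x y *
        (h x y / sample_prob l \<epsilon> \<gamma> (lab x = lab y) (d x) (h x y))))"

section \<open>Cut weight inside and between the parts of a partition\<close>

locale weight_class =
  fixes V :: "nat set" and g :: "nat \<Rightarrow> nat \<Rightarrow> real" and \<beta> :: real
  assumes fin: "finite V" and sym: "g x y = g y x" and \<beta>_pos: "0 < \<beta>"
    and range: "g x y = 0 \<or> \<beta> \<le> g x y \<and> g x y < 2 * \<beta>"
begin

lemma nonneg: "0 \<le> g x y"
  using range[of x y] \<beta>_pos by linarith

definition cut :: "nat set \<Rightarrow> real" where
  "cut S = (\<Sum>x\<in>V \<inter> S. \<Sum>y\<in>V - S. g x y)"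

lemma cut_nonneg: "0 \<le> cut S"
  unfolding cut_def by (intro sum_nonneg nonneg)

definition deg :: "(nat \<Rightarrow> nat) \<Rightarrow> nat \<Rightarrow> real" where
  "deg lab x = (\<Sum>y\<in>{y \<in> V. lab y = lab x}. g x y)"

lemma deg_nonneg: "0 \<le> deg lab x"
  unfolding deg_def by (intro sum_nonneg nonneg)

definition inner_cut :: "(nat \<Rightarrow> nat) \<Rightarrow> nat set \<Rightarrow> real" where
  "inner_cut lab S = (\<Sum>x\<in>V. \<Sum>y\<in>V. if lab x = lab y \<and> x \<in> S \<and> y \<notin> S then g x y else 0)"

text \<open>Doubling symmetrises the sum: the condition on the pair becomes
  \<open>(x \<in> S) \<noteq> (y \<in> S)\<close>, which is unchanged when \<open>S\<close> is
  complemented within a part.\<close>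

lemma inner_cut_alt:
  "2 * inner_cut lab S = (\<Sum>x\<in>V. \<Sum>y\<in>V. if lab x = lab y \<and> (x \<in> S) \<noteq> (y \<in> S) then g x y else 0)"
proof -
  have "inner_cut lab S = (\<Sum>x\<in>V. \<Sum>y\<in>V. if lab x = lab y \<and> x \<notin> S \<and> y \<in> S then g x y else 0)"
    unfolding inner_cut_def by (subst sum.swap) (intro sum.cong, auto simp: sym)
  then have "2 * inner_cut lab S = (\<Sum>x\<in>V. \<Sum>y\<in>V. if lab x = lab y \<and> x \<in> S \<and> y \<notin> S then g x y else 0)
     + (\<Sum>x\<in>V. \<Sum>y\<in>V. if lab x = lab y \<and> x \<notin> S \<and> y \<in> S then g x y else 0)"
    unfolding inner_cut_def by simp
  then show ?thesis
    by (simp flip: sum.distrib) (intro sum.cong, auto)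
qed

lemma smaller_sides_separates:
  assumes "x \<in> V" "y \<in> V" "lab x = lab y"
  shows "(x \<in> smaller_sides V lab S) \<noteq> (y \<in> smaller_sides V lab S) \<longleftrightarrow> (x \<in> S) \<noteq> (y \<in> S)"
  using assms by (auto simp: smaller_sides_def)

lemma inner_cut_smaller_sides: "inner_cut lab (smaller_sides V lab S) = inner_cut lab S"
proof -
  have "2 * inner_cut lab (smaller_sides V lab S) = 2 * inner_cut lab S"
    unfolding inner_cut_alt
    by (intro sum.cong refl if_cong conj_cong smaller_sides_separates)
  then show ?thesis by simp
qed

lemma smaller_sides_subset: "smaller_sides V lab S \<subseteq> V"
  by (auto simp: smaller_sides_def)

lemma cut_split:
  "cut S = inner_cut lab S + (\<Sum>x\<in>V. \<Sum>y\<in>V. if lab x \<noteq> lab y \<and> x \<in> S \<and> y \<notin> S then g x y else 0)"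
proof -
  have "cut S = (\<Sum>x\<in>V. \<Sum>y\<in>V. if x \<in> S \<and> y \<notin> S then g x y else 0)"
  proof -
    have "cut S = (\<Sum>x\<in>V. if x \<in> S then \<Sum>y\<in>V. if y \<notin> S then g x y else 0 else 0)"
      unfolding cut_def using fin by (simp add: sum.inter_restrict set_diff_eq sum.inter_filter flip: Collect_neg_eq)
    then show ?thesis
      by (simp) (intro sum.cong, auto)
  qed
  then show ?thesis
    unfolding inner_cut_def by (simp flip: sum.distrib) (intro sum.cong, auto)
qed

lemma inner_cut_le: "inner_cut lab S \<le> cut S"
  unfolding cut_split[of S lab] by (simp add: sum_nonneg nonneg)

text \<open>The degree of a vertex of \<open>T\<close> within its part splits into weight that
  leaves \<open>T\<close> and weight that stays in \<open>T\<close>; the first sums to the inner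
  cut.\<close>

lemma inner_cut_deg:
  assumes "T \<subseteq> V"
  shows "inner_cut lab T = (\<Sum>x\<in>T. deg lab x) - (\<Sum>x\<in>T. \<Sum>y\<in>{y \<in> T. lab y = lab x}. g x y)"
proof -
  have "inner_cut lab T = (\<Sum>x\<in>T. \<Sum>y\<in>{y \<in> V. lab y = lab x} - {y \<in> T. lab y = lab x}. g x y)"
  proof -
    have "inner_cut lab T = (\<Sum>x\<in>V. if x \<in> T then \<Sum>y\<in>V. if lab x = lab y \<and> y \<notin> T then g x y else 0 else 0)"
      unfolding inner_cut_def by (intro sum.cong, auto)
    also have "\<dots> = (\<Sum>x\<in>T. \<Sum>y\<in>V. if lab x = lab y \<and> y \<notin> T then g x y else 0)"
      using fin assms by (simp add: sum.If_cases Int_absorb1)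
    also have "\<dots> = (\<Sum>x\<in>T. \<Sum>y\<in>{y \<in> V. lab y = lab x} - {y \<in> T. lab y = lab x}. g x y)"
      using fin by (intro sum.cong refl sum.mono_neutral_cong_right) auto
    finally show ?thesis .
  qed
  also have "\<dots> = (\<Sum>x\<in>T. deg lab x - (\<Sum>y\<in>{y \<in> T. lab y = lab x}. g x y))"
    unfolding deg_def using fin assms by (intro sum.cong refl sum_diff) auto
  finally show ?thesis by (simp add: sum_subtractf)
qed

end

section \<open>Consequences of expansion\<close>

locale decomposed_class = weight_class +
  fixes lab :: "nat \<Rightarrow> nat" and \<tau> :: real
  assumes \<tau>_pos: "0 < \<tau>"
    and expands: "T \<subseteq> {x \<in> V. lab x = c} \<Longrightarrow> 2 * card T \<le> card {x \<in> V. lab x = c} \<Longrightarrow>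
      \<tau> * card T \<le> (\<Sum>x\<in>T. \<Sum>y\<in>{x \<in> V. lab x = c} - T. g x y)"
begin

text \<open>Expansion applies to the smaller side in every part. The boundary weights add up to the
  inner cut of these sides, which equals that of \<open>S\<close>.\<close>

lemma card_smaller_sides_le: "\<tau> * card (smaller_sides V lab S) \<le> cut S"
proof -
  let ?T = "smaller_sides V lab S"
  let ?C = "\<lambda>c. {x \<in> V. lab x = c}"
  have finT: "finite ?T" using fin smaller_sides_subset finite_subset by blast
  have half: "2 * card (?T \<inter> ?C c) \<le> card (?C c)" for c
  proof (cases "2 * card {y \<in> V. lab y = c \<and> y \<in> S} \<le> card (?C c)")
    case True
    have "?T \<inter> ?C c = {y \<in> V. lab y = c \<and> y \<in> S}"
      using True by (auto simp: smaller_sides_def)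
    then show ?thesis using True by simp
  next
    case False
    have "?T \<inter> ?C c = ?C c - {y \<in> V. lab y = c \<and> y \<in> S}"
      using False by (auto simp: smaller_sides_def)
    moreover have "card (?C c - {y \<in> V. lab y = c \<and> y \<in> S}) = card (?C c) - card {y \<in> V. lab y = c \<and> y \<in> S}"
      using fin by (intro card_Diff_subset) auto
    ultimately show ?thesis using False by simp
  qed
  have "real (card ?T) = (\<Sum>c\<in>lab ` V. real (card (?T \<inter> ?C c)))"
  proof -
    have "?T = (\<Union>c\<in>lab ` V. ?T \<inter> ?C c)" using smaller_sides_subset by auto
    then have "card ?T = card (\<Union>c\<in>lab ` V. ?T \<inter> ?C c)" by simp
    also have "\<dots> = (\<Sum>c\<in>lab ` V. card (?T \<inter> ?C c))"
      using fin finT by (intro card_UN_disjoint) auto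
    finally show ?thesis by simp
  qed
  then have "\<tau> * card ?T = (\<Sum>c\<in>lab ` V. \<tau> * card (?T \<inter> ?C c))"
    by (simp add: sum_distrib_left)
  also have "\<dots> \<le> (\<Sum>c\<in>lab ` V. \<Sum>x\<in>?T \<inter> ?C c. \<Sum>y\<in>?C c - (?T \<inter> ?C c). g x y)"
    by (intro sum_mono expands half) auto
  also have "\<dots> = (\<Sum>c\<in>lab ` V. \<Sum>x\<in>?C c. \<Sum>y\<in>V. if lab x = lab y \<and> x \<in> ?T \<and> y \<notin> ?T then g x y else 0)"
  proof (rule sum.cong[OF refl])
    fix c
    have "(\<Sum>x\<in>?C c. \<Sum>y\<in>V. if lab x = lab y \<and> x \<in> ?T \<and> y \<notin> ?T then g x y else 0)
        = (\<Sum>x\<in>?T \<inter> ?C c. \<Sum>y\<in>V. if lab x = lab y \<and> x \<in> ?T \<and> y \<notin> ?T then g x y else 0)"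
      by (intro sum.mono_neutral_right ballI sum.neutral) (use fin in auto)
    also have "\<dots> = (\<Sum>x\<in>?T \<inter> ?C c. \<Sum>y\<in>?C c - (?T \<inter> ?C c). g x y)"
      using fin by (intro sum.cong refl sum.mono_neutral_cong_right) auto
    finally show "(\<Sum>x\<in>?T \<inter> ?C c. \<Sum>y\<in>?C c - (?T \<inter> ?C c). g x y) =
      (\<Sum>x\<in>?C c. \<Sum>y\<in>V. if lab x = lab y \<and> x \<in> ?T \<and> y \<notin> ?T then g x y else 0)" ..
  qed
  also have "\<dots> = inner_cut lab ?T"
    unfolding inner_cut_def using fin by (intro sum.image_gen[symmetric])
  also have "\<dots> \<le> cut S"
    by (simp add: inner_cut_smaller_sides inner_cut_le)
  finally show ?thesis .
qed

text \<open>In a part with at least two vertices, expansion of a singleton would give a vertex of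
  degree at least \<open>\<tau>\<close>, but degrees are at most
  \<open>2 * \<beta> * card V\<close>. In a singleton part the smaller side is empty. This makes the
  search for a scale end.\<close>

lemma smaller_sides_empty:
  assumes "2 * \<beta> * card V < \<tau>"
  shows "smaller_sides V lab S = {}"
proof (rule ccontr)
  let ?T = "smaller_sides V lab S"
  assume "?T \<noteq> {}"
  then obtain x where x: "x \<in> ?T" by blast
  let ?C = "{y \<in> V. lab y = lab x}"
  have xV: "x \<in> V" using x smaller_sides_subset by blast
  have "2 * card {x} \<le> card ?C"
  proof (rule ccontr)
    assume "\<not> ?thesis"
    then have "card ?C \<le> Suc 0" by simp
    then have "\<forall>y\<in>?C. \<forall>z\<in>?C. y = z"
      using fin by (subst (asm) card_le_Suc0_iff_eq) auto
    then have C: "?C = {x}" using xV by auto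
    then have "{y \<in> V. lab y = lab x \<and> y \<in> S} = (if x \<in> S then {x} else {})" by auto
    with C x show False by (auto simp: smaller_sides_def split: if_splits)
  qed
  then have "\<tau> * card {x} \<le> (\<Sum>z\<in>{x}. \<Sum>y\<in>?C - {x}. g z y)"
    by (intro expands) (use xV in auto)
  also have "\<dots> \<le> (\<Sum>y\<in>V. 2 * \<beta>)"
  proof -
    have "(\<Sum>y\<in>?C - {x}. g x y) \<le> (\<Sum>y\<in>V. g x y)"
      using fin nonneg by (intro sum_mono2) auto
    also have "\<dots> \<le> (\<Sum>y\<in>V. 2 * \<beta>)"
      using range \<beta>_pos by (intro sum_mono) (metis less_eq_real_def mult_pos_pos zero_less_numeral)
    finally show ?thesis by simp
  qed
  finally show False using assms by (simp add: mult.commute mult.left_commute)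
qed

lemma smaller_sides_pairs_le: 
  "(\<Sum>y\<in>{y \<in> smaller_sides V lab S. lab y = lab x}. g x y) \<le> 2 * \<beta> * card (smaller_sides V lab S)"
proof -
  let ?T = "smaller_sides V lab S"
  have finT: "finite ?T" using fin smaller_sides_subset finite_subset by blast
  have "(\<Sum>y\<in>{y \<in> ?T. lab y = lab x}. g x y) \<le> (\<Sum>y\<in>?T. g x y)"
    using finT nonneg by (intro sum_mono2) auto
  also have "\<dots> \<le> (\<Sum>y\<in>?T. 2 * \<beta>)"
    using range \<beta>_pos by (intro sum_mono) (metis less_eq_real_def mult_pos_pos zero_less_numeral)
  finally show ?thesis by (simp add: mult.commute)
qed

text \<open>The degrees exceed the inner cut by the pairs inside the set. These cost at most
  \<open>2 * \<tau>\<close> per vertex by the assumption, hence \<open>2 * cut S\<close> in all by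
  expansion.\<close>

lemma sum_deg_smaller_sides_le:
  assumes "\<beta> * card (smaller_sides V lab S) \<le> \<tau>"
  shows "(\<Sum>x\<in>smaller_sides V lab S. deg lab x) \<le> 3 * cut S"
proof -
  let ?T = "smaller_sides V lab S"
  have "(\<Sum>x\<in>?T. \<Sum>y\<in>{y \<in> ?T. lab y = lab x}. g x y) \<le> (\<Sum>x\<in>?T. 2 * (\<beta> * card ?T))"
    using smaller_sides_pairs_le by (intro sum_mono) (simp add: mult.assoc)
  also have "\<dots> \<le> (\<Sum>x\<in>?T. 2 * \<tau>)"
    using assms by (intro sum_mono) auto
  also have "\<dots> \<le> 2 * cut S"
    using card_smaller_sides_le[of S] by (simp add: mult.commute)
  finally show ?thesis
    using inner_cut_deg[of "smaller_sides V lab S" lab, OF smaller_sides_subset] inner_cut_le[of lab S]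
    by (simp add: inner_cut_smaller_sides)
qed

end

section \<open>Error, variance and cost of sampling one class at one scale\<close>

locale sampled_class = decomposed_class V g \<beta> lab "\<gamma> / \<epsilon>"
  for V :: "nat set" and g :: "nat \<Rightarrow> nat \<Rightarrow> real" and \<beta> :: real and lab :: "nat \<Rightarrow> nat" and \<gamma> \<epsilon> :: real +
  fixes l :: real
  assumes \<epsilon>: "0 < \<epsilon>" "\<epsilon> \<le> 1" and \<gamma>: "\<beta> \<le> \<gamma>" and l: "1 \<le> l"
begin

definition pairs :: "(nat \<times> nat) set" where
  "pairs = {(x, y). x \<in> V \<and> y \<in> V \<and> 0 < g x y}"

definition prob :: "nat \<times> nat \<Rightarrow> real" where
  "prob = (\<lambda>(x, y). sample_prob l \<epsilon> \<gamma> (lab x = lab y) (deg lab x) (g x y))"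

definition coeff :: "nat set \<Rightarrow> nat \<times> nat \<Rightarrow> real" where
  "coeff S = (\<lambda>(x, y). pair_sign lab (smaller_sides V lab S) S x y * g x y)"

lemma \<gamma>_pos: "0 < \<gamma>" using \<gamma> \<beta>_pos by linarith

lemma finite_pairs: "finite pairs"
  by (rule finite_subset[of _ "V \<times> V"]) (auto simp: pairs_def fin)

lemma sum_pairs: "(\<Sum>z\<in>pairs. f z) = (\<Sum>x\<in>V. \<Sum>y\<in>V. if 0 < g x y then f (x, y) else (0::real))"
proof -
  have "(\<Sum>z\<in>pairs. f z) = (\<Sum>z\<in>V \<times> V. if 0 < g (fst z) (snd z) then f z else 0)"
    using fin by (intro sum.mono_neutral_cong_left) (auto simp: pairs_def)
  also have "\<dots> = (\<Sum>x\<in>V. \<Sum>y\<in>V. if 0 < g x y then f (x, y) else (0::real))"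
    unfolding sum.cartesian_product by (intro sum.cong) auto
  finally show ?thesis .
qed

lemma le_deg: "x \<in> V \<Longrightarrow> y \<in> V \<Longrightarrow> lab x = lab y \<Longrightarrow> g x y \<le> deg lab x"
  unfolding deg_def using fin nonneg by (intro member_le_sum) auto

lemma prob_pos: "z \<in> pairs \<Longrightarrow> 0 < prob z" and prob_le_1: "prob z \<le> 1"
proof -
  assume z: "z \<in> pairs"
  obtain x y where xy: "z = (x, y)" by force
  then have "x \<in> V" "y \<in> V" "0 < g x y" using z by (auto simp: pairs_def)
  with le_deg[of x y] show "0 < prob z"
    using \<epsilon> \<gamma>_pos l by (auto simp: xy prob_def sample_prob_def)
qed (auto simp: prob_def sample_prob_def split: prod.split)

text \<open>The identity behind the estimator: degrees are stored exactly, so only the signed sum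
  over pairs is left to sampling.\<close>

lemma cut_eq: "cut S = (\<Sum>x\<in>smaller_sides V lab S. deg lab x) + (\<Sum>z\<in>pairs. coeff S z)"
proof -
  let ?T = "smaller_sides V lab S"
  have T: "?T \<subseteq> V" by (rule smaller_sides_subset)
  have "(\<Sum>x\<in>?T. \<Sum>y\<in>{y \<in> ?T. lab y = lab x}. g x y)
      = (\<Sum>x\<in>V. \<Sum>y\<in>V. if lab x = lab y \<and> x \<in> ?T \<and> y \<in> ?T then g x y else 0)"
  proof -
    have "(\<Sum>x\<in>?T. \<Sum>y\<in>{y \<in> ?T. lab y = lab x}. g x y)
      = (\<Sum>x\<in>?T. \<Sum>y\<in>V. if lab x = lab y \<and> x \<in> ?T \<and> y \<in> ?T then g x y else 0)"
      using fin T by (intro sum.cong refl sum.mono_neutral_cong_left) auto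
    also have "\<dots> = (\<Sum>x\<in>V. \<Sum>y\<in>V. if lab x = lab y \<and> x \<in> ?T \<and> y \<in> ?T then g x y else 0)"
      by (intro sum.mono_neutral_left ballI sum.neutral) (use fin T in auto)
    finally show ?thesis .
  qed
  then have "cut S = (\<Sum>x\<in>?T. deg lab x)
      - (\<Sum>x\<in>V. \<Sum>y\<in>V. if lab x = lab y \<and> x \<in> ?T \<and> y \<in> ?T then g x y else 0)
      + (\<Sum>x\<in>V. \<Sum>y\<in>V. if lab x \<noteq> lab y \<and> x \<in> S \<and> y \<notin> S then g x y else 0)"
    using cut_split[of S lab] inner_cut_deg[OF T, of lab] inner_cut_smaller_sides[of lab S] by simp
  also have "\<dots> = (\<Sum>x\<in>?T. deg lab x) +
      (\<Sum>x\<in>V. \<Sum>y\<in>V. (if lab x \<noteq> lab y \<and> x \<in> S \<and> y \<notin> S then g x y else 0)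
        - (if lab x = lab y \<and> x \<in> ?T \<and> y \<in> ?T then g x y else 0))"
    by (simp add: sum_subtractf)
  also have "(\<Sum>x\<in>V. \<Sum>y\<in>V. (if lab x \<noteq> lab y \<and> x \<in> S \<and> y \<notin> S then g x y else 0)
        - (if lab x = lab y \<and> x \<in> ?T \<and> y \<in> ?T then g x y else 0)) = (\<Sum>z\<in>pairs. coeff S z)"
    unfolding sum_pairs
  proof (intro sum.cong refl)
    fix x y
    show "(if lab x \<noteq> lab y \<and> x \<in> S \<and> y \<notin> S then g x y else 0)
        - (if lab x = lab y \<and> x \<in> ?T \<and> y \<in> ?T then g x y else 0) = (if 0 < g x y then coeff S (x, y) else 0)"
      using nonneg[of x y] by (auto simp: coeff_def pair_sign_def)
  qed
  finally show ?thesis .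
qed

text \<open>The assumptions on \<open>d\<close>, \<open>h\<close> and \<open>lab'\<close> are
  restricted to \<open>V\<close>, since the decoder reads these functions from a table that says
  nothing elsewhere. The degrees cancel, and the error takes the form treated by Bernstein's
  inequality.\<close>

lemma layer_est_error:
  assumes d: "\<And>x. x \<in> V \<Longrightarrow> d x = deg lab x"
    and h: "\<And>x y. x \<in> V \<Longrightarrow> y \<in> V \<Longrightarrow> h x y = (if 0 < g x y \<and> \<omega> (x, y) then g x y else 0)"
    and lab': "\<And>x. x \<in> V \<Longrightarrow> lab' x = lab x"
  shows "layer_est l \<epsilon> \<gamma> V lab' d h S - cut S = (\<Sum>z\<in>pairs. coeff S z * (of_bool (\<omega> z) / prob z - 1))"
proof -
  let ?T = "smaller_sides V lab S"
  have eqT: "smaller_sides V lab' S = ?T"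
    unfolding smaller_sides_def by (simp add: lab' cong: conj_cong)
  have T: "?T \<subseteq> V" by (rule smaller_sides_subset)
  have "layer_est l \<epsilon> \<gamma> V lab' d h S = (\<Sum>x\<in>?T. d x) + (\<Sum>x\<in>V. \<Sum>y\<in>V. pair_sign lab' ?T S x y *
        (h x y / sample_prob l \<epsilon> \<gamma> (lab' x = lab' y) (d x) (h x y)))"
    unfolding layer_est_def Let_def eqT ..
  also have "(\<Sum>x\<in>?T. d x) = (\<Sum>x\<in>?T. deg lab x)"
    using T d by (intro sum.cong) auto
  also have "(\<Sum>x\<in>V. \<Sum>y\<in>V. pair_sign lab' ?T S x y *
        (h x y / sample_prob l \<epsilon> \<gamma> (lab' x = lab' y) (d x) (h x y)))
      = (\<Sum>z\<in>pairs. coeff S z * (of_bool (\<omega> z) / prob z))"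
    unfolding sum_pairs
    by (intro sum.cong refl) (simp add: h d lab' coeff_def prob_def pair_sign_def)
  finally show ?thesis
    using cut_eq[of S] by (simp add: algebra_simps sum.distrib sum_subtractf)
qed

text \<open>What the choice of scale provides. \<open>few\<close> is the selection criterion itself;
  \<open>heavy\<close> says that the scale is the lowest one or that the scale below it failed,
  which forces a large cut.\<close>

context
  fixes S :: "nat set"
  assumes few: "\<epsilon> * card (smaller_sides V lab S) \<le> 1"
    and heavy: "\<gamma> = \<beta> \<or> \<gamma> \<le> 2 * \<epsilon>\<^sup>2 * cut S"
begin

lemma sum_deg_le: "(\<Sum>x\<in>smaller_sides V lab S. deg lab x) \<le> 3 * cut S"
proof (rule sum_deg_smaller_sides_le)
  have "\<beta> * card (smaller_sides V lab S) \<le> \<beta> * (1 / \<epsilon>)"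
    using few \<epsilon> \<beta>_pos by (intro mult_left_mono) (auto simp: field_simps)
  also have "\<dots> \<le> \<gamma> / \<epsilon>"
    using \<gamma> \<epsilon> by (simp add: divide_right_mono)
  finally show "\<beta> * card (smaller_sides V lab S) \<le> \<gamma> / \<epsilon>" .
qed

lemma prob_less_1_cases:
  assumes "z \<in> pairs" "prob z < 1" "coeff S z \<noteq> 0"
  obtains (inside) x y where "z = (x, y)" "lab x = lab y" "x \<in> smaller_sides V lab S"
      "y \<in> smaller_sides V lab S" "prob z = l * g x y / (\<epsilon> * deg lab x)" "coeff S z = - g x y" "0 < g x y" "0 < deg lab x"
    | (cross) x y where "z = (x, y)" "lab x \<noteq> lab y" "x \<in> V \<inter> S" "y \<in> V - S"
      "prob z = l * g x y / \<gamma>" "coeff S z = g x y" "\<gamma> \<le> 2 * \<epsilon>\<^sup>2 * cut S" "0 < g x y"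
proof -
  obtain x y where z: "z = (x, y)" by force
  have xy: "x \<in> V" "y \<in> V" "0 < g x y" using assms(1) by (auto simp: z pairs_def)
  show thesis
  proof (cases "lab x = lab y")
    case True
    have "0 < deg lab x" using le_deg[OF xy(1,2) True] xy(3) by simp
    then show ?thesis
      using True assms xy by (intro inside[of x y])
        (auto simp: z prob_def sample_prob_def coeff_def pair_sign_def split: if_splits)
  next
    case False
    \<comment> \<open>At the lowest scale every pair between parts is kept with probability 1,
      because its weight is at least \<open>\<beta>\<close>.\<close>
    have "\<gamma> \<noteq> \<beta>"
    proof
      assume eq: "\<gamma> = \<beta>"
      have "1 * \<gamma> \<le> l * g x y"
        using range[of x y] xy(3) l \<gamma>_pos eq by (intro mult_mono) auto
      then have "1 \<le> l * g x y / \<gamma>"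
        using \<gamma>_pos by (simp add: field_simps)
      then show False using assms(2) False by (simp add: z prob_def sample_prob_def)
    qed
    then show ?thesis
      using False assms xy heavy by (intro cross[of x y])
        (auto simp: z prob_def sample_prob_def coeff_def pair_sign_def split: if_splits)
  qed
qed

text \<open>The range condition of Bernstein's inequality. Inside a part, coefficient over
  probability is \<open>\<epsilon> * deg lab x / l\<close> in absolute value, and a single degree is
  at most \<open>3 * cut S\<close>. Between parts it is \<open>\<gamma> / l\<close>, which
  \<open>heavy\<close> bounds.\<close>

lemma coeff_le_prob:
  assumes "z \<in> pairs" "prob z < 1"
  shows "l * \<bar>coeff S z\<bar> \<le> 3 * \<epsilon> * cut S * prob z"
proof (cases "coeff S z = 0")
  case True
  then show ?thesis using prob_pos[OF assms(1)] cut_nonneg \<epsilon> by simp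
next
  case False
  from assms this show ?thesis
  proof (cases rule: prob_less_1_cases)
    case (inside x y)
    have "deg lab x \<le> (\<Sum>x\<in>smaller_sides V lab S. deg lab x)"
      using inside(3) deg_nonneg finite_subset[OF smaller_sides_subset fin] by (intro member_le_sum) auto
    then have "deg lab x \<le> 3 * cut S" using sum_deg_le by linarith
    then have "deg lab x * (l * g x y) \<le> 3 * cut S * (l * g x y)"
      using inside l by (intro mult_right_mono) auto
    then have "l * g x y \<le> 3 * cut S * (l * g x y) / deg lab x"
      using inside(8) by (simp add: field_simps)
    also have "\<dots> = 3 * \<epsilon> * cut S * (l * g x y / (\<epsilon> * deg lab x))"
      using inside(8) \<epsilon> by (simp add: field_simps)
    finally show ?thesis unfolding inside(5,6) using inside(7) by simp
  next
    case (cross x y)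
    have "\<epsilon>\<^sup>2 \<le> \<epsilon>"
      using \<epsilon> by (simp add: power2_eq_square mult_left_le)
    then have "\<epsilon>\<^sup>2 * cut S \<le> \<epsilon> * cut S"
      using cut_nonneg by (intro mult_right_mono)
    moreover have "0 \<le> \<epsilon> * cut S" using \<epsilon> cut_nonneg by simp
    ultimately have "\<gamma> \<le> 3 * \<epsilon> * cut S" using cross(7) by linarith
    then have "\<gamma> * (l * g x y) \<le> 3 * \<epsilon> * cut S * (l * g x y)"
      using cross l by (intro mult_right_mono) auto
    then show ?thesis
      unfolding cross(5,6) using cross(8) \<gamma>_pos by (simp add: field_simps)
  qed
qed

text \<open>The 8 is 6 + 2. Inside parts a term is
  \<open>\<epsilon> / l * (deg lab x * g x y)\<close>, where the weights from \<open>x\<close> into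
  the set sum to at most \<open>2 * \<epsilon> * cut S\<close> and the degrees to at most
  \<open>3 * cut S\<close>. Between parts a term is \<open>\<gamma> / l * g x y\<close>, and the
  weights sum to at most \<open>cut S\<close>.\<close>

lemma variance_le:
  "(\<Sum>z\<in>{z \<in> pairs. prob z < 1}. (coeff S z)\<^sup>2 / prob z) \<le> 8 * \<epsilon>\<^sup>2 * (cut S)\<^sup>2 / l"
proof -
  let ?T = "smaller_sides V lab S"
  define A where "A x y = (if lab x = lab y \<and> x \<in> ?T \<and> y \<in> ?T then \<epsilon> / l * (deg lab x * g x y) else 0)" for x y
  define B where "B x y = (if x \<in> S \<and> y \<notin> S then 2 * \<epsilon>\<^sup>2 * cut S / l * g x y else 0)" for x y
  have A0: "0 \<le> A x y" and B0: "0 \<le> B x y" for x y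
    using \<epsilon> l nonneg deg_nonneg cut_nonneg by (auto simp: A_def B_def)
  have "(coeff S z)\<^sup>2 / prob z \<le> A (fst z) (snd z) + B (fst z) (snd z)" if z: "z \<in> pairs" "prob z < 1" for z
  proof (cases "coeff S z = 0")
    case True
    then show ?thesis using A0 B0 by simp
  next
    case False
    from z this show ?thesis
    proof (cases rule: prob_less_1_cases)
      case (inside x y)
      have "(coeff S z)\<^sup>2 / prob z = \<epsilon> / l * (deg lab x * g x y)"
        unfolding inside(5,6) using inside(7,8) \<epsilon> l by (simp add: field_simps power2_eq_square)
      then show ?thesis using inside B0[of x y] by (simp add: A_def)
    next
      case (cross x y)
      have "(coeff S z)\<^sup>2 / prob z = \<gamma> / l * g x y"
        unfolding cross(5,6) using cross(8) l \<gamma>_pos by (simp add: field_simps power2_eq_square)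
      also have "\<dots> \<le> 2 * \<epsilon>\<^sup>2 * cut S / l * g x y"
        using cross l by (intro mult_right_mono divide_right_mono) auto
      finally show ?thesis using cross A0[of x y] by (simp add: B_def)
    qed
  qed
  then have "(\<Sum>z\<in>{z \<in> pairs. prob z < 1}. (coeff S z)\<^sup>2 / prob z)
      \<le> (\<Sum>z\<in>{z \<in> pairs. prob z < 1}. A (fst z) (snd z) + B (fst z) (snd z))"
    by (intro sum_mono) auto
  also have "\<dots> \<le> (\<Sum>z\<in>V \<times> V. A (fst z) (snd z) + B (fst z) (snd z))"
    using fin A0 B0 by (intro sum_mono2) (auto simp: pairs_def)
  also have "\<dots> = (\<Sum>x\<in>V. \<Sum>y\<in>V. A x y) + (\<Sum>x\<in>V. \<Sum>y\<in>V. B x y)"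
    by (simp add: sum.cartesian_product split_def sum.distrib)
  also have "(\<Sum>x\<in>V. \<Sum>y\<in>V. B x y) = 2 * \<epsilon>\<^sup>2 * cut S / l * cut S"
  proof -
    have "(\<Sum>x\<in>V. \<Sum>y\<in>V. B x y) = (\<Sum>x\<in>V \<inter> S. \<Sum>y\<in>V. B x y)"
      by (intro sum.mono_neutral_right ballI sum.neutral) (use fin in \<open>auto simp: B_def\<close>)
    also have "\<dots> = (\<Sum>x\<in>V \<inter> S. \<Sum>y\<in>V - S. B x y)"
      by (intro sum.cong refl sum.mono_neutral_right) (use fin in \<open>auto simp: B_def\<close>)
    also have "\<dots> = 2 * \<epsilon>\<^sup>2 * cut S / l * cut S"
    proof -
      have "(\<Sum>x\<in>V \<inter> S. \<Sum>y\<in>V - S. c * g x y) = c * cut S" for c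
        by (simp only: cut_def sum_distrib_left)
      from this[of "2 * \<epsilon>\<^sup>2 * cut S / l"] show ?thesis by (simp add: B_def)
    qed
    finally show ?thesis .
  qed
  also have "(\<Sum>x\<in>V. \<Sum>y\<in>V. A x y) \<le> 6 * \<epsilon>\<^sup>2 * (cut S)\<^sup>2 / l"
  proof -
    have finT: "finite ?T" using fin smaller_sides_subset finite_subset by blast
    \<comment> \<open>Expansion at \<open>\<gamma> / \<epsilon>\<close> bounds the size of
      \<open>?T\<close>, and with \<open>\<beta> \<le> \<gamma>\<close> this bounds the weight from
      one vertex into \<open>?T\<close>.\<close>
    have "\<beta> * card ?T \<le> \<gamma> * card ?T"
      using \<gamma> by (intro mult_right_mono) auto
    also have "\<dots> \<le> \<epsilon> * cut S"
      using card_smaller_sides_le[of S] \<epsilon> by (simp add: field_simps)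
    finally have bT: "2 * \<beta> * card ?T \<le> 2 * \<epsilon> * cut S" by simp
    have "(\<Sum>x\<in>V. \<Sum>y\<in>V. A x y) = (\<Sum>x\<in>?T. \<Sum>y\<in>V. A x y)"
      by (intro sum.mono_neutral_right ballI sum.neutral) (use fin smaller_sides_subset in \<open>auto simp: A_def\<close>)
    also have "\<dots> = (\<Sum>x\<in>?T. \<Sum>y\<in>{y \<in> ?T. lab y = lab x}. \<epsilon> / l * (deg lab x * g x y))"
      by (intro sum.cong refl sum.mono_neutral_cong_right) (use fin smaller_sides_subset in \<open>auto simp: A_def\<close>)
    also have "\<dots> = (\<Sum>x\<in>?T. \<epsilon> / l * (deg lab x * (\<Sum>y\<in>{y \<in> ?T. lab y = lab x}. g x y)))"
      by (simp add: sum_distrib_left)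
    also have "\<dots> \<le> (\<Sum>x\<in>?T. \<epsilon> / l * (deg lab x * (2 * \<epsilon> * cut S)))"
      using \<epsilon> l deg_nonneg
      by (intro sum_mono mult_left_mono order_trans[OF smaller_sides_pairs_le bT]) auto
    also have "\<dots> = \<epsilon> / l * (2 * \<epsilon> * cut S) * (\<Sum>x\<in>?T. deg lab x)"
      unfolding sum_distrib_left by (intro sum.cong) (simp_all add: algebra_simps)
    also have "\<dots> \<le> \<epsilon> / l * (2 * \<epsilon> * cut S) * (3 * cut S)"
      using sum_deg_le \<epsilon> l cut_nonneg by (intro mult_left_mono) auto
    finally show ?thesis by (simp add: power2_eq_square)
  qed
  finally show ?thesis by (simp add: power2_eq_square field_simps)
qed

end

text \<open>Normalisation by the degree makes the rates inside a part sum to at most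
  \<open>l / \<epsilon>\<close> per vertex. The rates between parts are paid for by the weight bound
  of the decomposition, in which \<open>\<gamma>\<close> cancels.\<close>

lemma sum_prob_le:
  assumes "(\<Sum>x\<in>V. \<Sum>y\<in>{y \<in> V. lab y \<noteq> lab x}. g x y) \<le> 2 * (\<gamma> / \<epsilon>) * (card V * log 2 (card V))"
  shows "(\<Sum>z\<in>pairs. prob z) \<le> l / \<epsilon> * (card V * (1 + 2 * log 2 (card V)))"
proof -
  have "(\<Sum>z\<in>pairs. prob z) \<le> (\<Sum>x\<in>V. \<Sum>y\<in>V.
      (if lab y = lab x then l / (\<epsilon> * deg lab x) * g x y else 0) + (if lab y \<noteq> lab x then l / \<gamma> * g x y else 0))"
    unfolding sum_pairs using nonneg deg_nonneg l \<epsilon> \<gamma>_pos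
    by (intro sum_mono) (auto simp: prob_def sample_prob_def)
  also have "\<dots> = (\<Sum>x\<in>V. (\<Sum>y\<in>{y \<in> V. lab y = lab x}. l / (\<epsilon> * deg lab x) * g x y)
      + (\<Sum>y\<in>{y \<in> V. lab y \<noteq> lab x}. l / \<gamma> * g x y))"
    unfolding sum.inter_filter[OF fin] sum.distrib ..
  also have "\<dots> = (\<Sum>x\<in>V. l / (\<epsilon> * deg lab x) * deg lab x) + l / \<gamma> * (\<Sum>x\<in>V. \<Sum>y\<in>{y \<in> V. lab y \<noteq> lab x}. g x y)"
    by (simp only: deg_def sum.distrib sum_distrib_left)
  \<comment> \<open>A vertex of degree 0 contributes 0, as division by zero gives 0, so the first
    sum is bounded rather than computed.\<close>
  also have "\<dots> \<le> (\<Sum>x\<in>V. l / \<epsilon>) + l / \<gamma> * (2 * (\<gamma> / \<epsilon>) * (card V * log 2 (card V)))"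
    using assms l \<epsilon> \<gamma>_pos by (intro add_mono sum_mono mult_left_mono) auto
  also have "\<dots> = l / \<epsilon> * (card V * (1 + 2 * log 2 (card V)))"
    using \<gamma>_pos \<epsilon> by (simp add: field_simps)
  finally show ?thesis .
qed

end

section \<open>Weight levels of a graph\<close>

text \<open>A single increase of \<open>f\<close> lies in at most \<open>c + 1\<close> of the
  windows from \<open>M - c\<close> to \<open>M + 1\<close>, and the total increase is at most
  \<open>n\<close>. Truncated subtraction only shortens the first windows.\<close>

lemma telescope_bounded:
  fixes f :: "nat \<Rightarrow> nat"
  assumes "mono f" "\<And>k. f k \<le> n"
  shows "(\<Sum>M<N. f (M + 1) - f (M - c)) \<le> (c + 1) * n"
proof (induction c)
  case 0
  have "(\<Sum>M<N. f (M + 1) - f M) = f N - f 0"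
    by (induction N) (use assms(1) in \<open>auto simp: mono_def\<close>)
  then show ?case using assms(2)[of N] by simp
next
  case (Suc c)
  have "(\<Sum>M<N. f (M - c) - f (M - Suc c)) \<le> n"
  proof -
    have "(\<Sum>M<N. f (M - c) - f (M - Suc c)) \<le> f (N - Suc c)"
    proof (induction N)
      case (Suc N)
      show ?case
      proof (cases "N \<ge> c")
        case True
        have "f (N - Suc c) \<le> f (N - c)" using assms(1) by (auto simp: mono_def)
        then show ?thesis using Suc True by (simp add: Suc_diff_le)
      qed (use Suc in auto)
    qed auto
    then show ?thesis using assms(2) le_trans by blast
  qed
  moreover have "f (M + 1) - f (M - Suc c) \<le> (f (M + 1) - f (M - c)) + (f (M - c) - f (M - Suc c))" for M
    by simp
  then have "(\<Sum>M<N. f (M + 1) - f (M - Suc c)) \<le> (\<Sum>M<N. f (M + 1) - f (M - c)) + (\<Sum>M<N. f (M - c) - f (M - Suc c))"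
    by (simp flip: sum.distrib) (intro sum_mono)
  ultimately show ?case using Suc by simp
qed

text \<open>On \<open>A\<close> every fibre of \<open>f\<close> has at least two elements, so
  \<open>f\<close> loses at least half of \<open>A\<close>; the elements outside \<open>A\<close>
  cannot make up for this loss.\<close>

lemma card_merged_le:
  assumes "finite R" "A \<subseteq> R" "\<And>x. x \<in> A \<Longrightarrow> \<exists>y\<in>A. y \<noteq> x \<and> f y = f x"
  shows "card A \<le> 2 * (card R - card (f ` R))"
proof -
  have finA: "finite A" using assms(1,2) finite_subset by blast
  have "2 * card (f ` A) = (\<Sum>c\<in>f ` A. 2)" by simp
  also have "\<dots> \<le> (\<Sum>c\<in>f ` A. card {x \<in> A. f x = c})"
  proof (rule sum_mono)
    fix c assume "c \<in> f ` A"
    then obtain x where x: "x \<in> A" "f x = c" by blast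
    with assms(3) obtain y where y: "y \<in> A" "y \<noteq> x" "f y = f x" by blast
    have "card {x, y} \<le> card {x \<in> A. f x = c}"
      using x y finA by (intro card_mono) auto
    then show "2 \<le> card {x \<in> A. f x = c}" using y by simp
  qed
  also have "\<dots> = card A"
    using sum.image_gen[OF finA, of "\<lambda>_. 1::nat" f] by simp
  finally have half: "2 * card (f ` A) \<le> card A" .
  have "card (f ` R) \<le> card (f ` A \<union> f ` (R - A))"
    using assms finA by (intro card_mono) auto
  also have "\<dots> \<le> card (f ` A) + card (R - A)"
    using card_Un_le[of "f ` A" "f ` (R - A)"] card_image_le[of "R - A" f] assms(1) by simp
  finally show ?thesis
    using half assms finA card_mono[OF assms(1,2)] by (simp add: card_Diff_subset)
qed

section \<open>Contracting heavy edges and rounding the others\<close>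

locale weighted_graph =
  fixes n L :: nat and W :: real and G :: wgraph
  assumes G: "G \<in> wgraphs n W" and n_le: "n \<le> 2 ^ L" and n_pos: "1 \<le> n"
begin

lemma edgeD:
  assumes "{u, v} \<in> edges G"
  shows "u < n" "v < n" "u \<noteq> v" "1 \<le> weight G {u, v}" "weight G {u, v} \<le> W"
  using assms G by (auto simp: wgraphs_def)

definition heavy :: "nat \<Rightarrow> (nat \<times> nat) set" where
  "heavy k = {(u, v). {u, v} \<in> edges G \<and> 2 ^ k \<le> weight G {u, v}}\<^sup>*"

text \<open>The least vertex is a canonical name of the component, and it stays among the vertices
  of the graph when \<open>x\<close> is one of them.\<close>

definition rep :: "nat \<Rightarrow> nat \<Rightarrow> nat" where
  "rep k x = (LEAST y. (x, y) \<in> heavy k)"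

lemma heavy_refl: "(x, x) \<in> heavy k"
  by (simp add: heavy_def)

lemma heavy_sym: "(x, y) \<in> heavy k \<Longrightarrow> (y, x) \<in> heavy k"
proof -
  have "sym (heavy k)"
    unfolding heavy_def by (intro sym_rtrancl) (auto simp: sym_def insert_commute)
  then show "(x, y) \<in> heavy k \<Longrightarrow> (y, x) \<in> heavy k" by (rule symD)
qed

lemma heavy_trans: "(x, y) \<in> heavy k \<Longrightarrow> (y, z) \<in> heavy k \<Longrightarrow> (x, z) \<in> heavy k"
  unfolding heavy_def by (rule rtrancl_trans)

lemma heavy_antimono: "k \<le> k' \<Longrightarrow> heavy k' \<subseteq> heavy k"
  unfolding heavy_def
  by (intro rtrancl_mono) (auto intro: order_trans[OF power_increasing])

lemma rep_heavy: "(x, rep k x) \<in> heavy k"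
  unfolding rep_def by (rule LeastI[of _ x]) (rule heavy_refl)

lemma rep_le: "rep k x \<le> x"
  unfolding rep_def by (rule Least_le) (rule heavy_refl)

lemma rep_eq_iff: "rep k x = rep k y \<longleftrightarrow> (x, y) \<in> heavy k"
proof
  assume "rep k x = rep k y"
  then show "(x, y) \<in> heavy k"
    using rep_heavy[of x k] heavy_sym[OF rep_heavy[of y k]] heavy_trans by metis
next
  assume "(x, y) \<in> heavy k"
  then have "(x, z) \<in> heavy k \<longleftrightarrow> (y, z) \<in> heavy k" for z
    using heavy_trans heavy_sym by blast
  then show "rep k x = rep k y" by (simp add: rep_def)
qed

lemma rep_rep: "k \<le> k' \<Longrightarrow> rep k (rep k' x) = rep k x"
  using rep_heavy[of x k'] heavy_antimono[of k k'] heavy_sym by (auto simp: rep_eq_iff)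

lemma rep_edge: "{u, v} \<in> edges G \<Longrightarrow> 2 ^ k \<le> weight G {u, v} \<Longrightarrow> rep k u = rep k v"
  unfolding rep_eq_iff heavy_def by (rule r_into_rtrancl) simp

text \<open>Cut edges are directed out of \<open>S\<close>, so that each of them occurs exactly
  once.\<close>

definition crossing :: "nat set \<Rightarrow> (nat \<times> nat) set" where
  "crossing S = {(u, v). {u, v} \<in> edges G \<and> u \<in> S \<and> v \<notin> S}"

lemma finite_crossing: "finite (crossing S)" and card_crossing_le: "card (crossing S) \<le> n * n"
proof -
  have sub: "crossing S \<subseteq> {..<n} \<times> {..<n}"
    using edgeD by (auto simp: crossing_def)
  then show "finite (crossing S)" by (rule finite_subset) simp
  show "card (crossing S) \<le> n * n"
    using card_mono[OF _ sub] by (simp add: card_cartesian_product)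
qed

lemma cut_weight_crossing: "cut_weight G S = (\<Sum>(u, v)\<in>crossing S. weight G {u, v})"
proof -
  have "{e \<in> edges G. card (e \<inter> S) = 1} = (\<lambda>(u, v). {u, v}) ` crossing S"
  proof (intro set_eqI iffI)
    fix e assume "e \<in> {e \<in> edges G. card (e \<inter> S) = 1}"
    then have e: "e \<in> edges G" "card (e \<inter> S) = 1" by auto
    moreover have "card e = 2" using e(1) G by (auto simp: wgraphs_def)
    ultimately obtain u v where uv: "e = {u, v}" "u \<noteq> v" by (meson card_2_iff)
    consider "u \<in> S" "v \<notin> S" | "v \<in> S" "u \<notin> S"
      using e(2) uv by (cases "u \<in> S"; cases "v \<in> S") auto
    then show "e \<in> (\<lambda>(u, v). {u, v}) ` crossing S"
    proof cases
      case 1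
      then show ?thesis using e uv by (intro image_eqI[of _ _ "(u, v)"]) (auto simp: crossing_def)
    next
      case 2
      then show ?thesis using e uv
        by (intro image_eqI[of _ _ "(v, u)"]) (auto simp: crossing_def insert_commute)
    qed
  next
    fix e assume "e \<in> (\<lambda>(u, v). {u, v}) ` crossing S"
    then obtain u v where uv: "e = {u, v}" "{u, v} \<in> edges G" "u \<in> S" "v \<notin> S"
      by (auto simp: crossing_def)
    then have "e \<inter> S = {u}" by auto
    then show "e \<in> {e \<in> edges G. card (e \<inter> S) = 1}" using uv by simp
  qed
  moreover have "inj_on (\<lambda>(u, v). {u, v}) (crossing S)"
    by (auto simp: inj_on_def crossing_def doubleton_eq_iff)
  ultimately show ?thesis
    unfolding cut_weight_def by (simp add: sum.reindex case_prod_unfold)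
qed

text \<open>A path of heavy edges can change sides only along an edge of the cut, so contracting it
  does not affect the query.\<close>

lemma rep_same_side:
  assumes "\<And>u v. (u, v) \<in> crossing S \<Longrightarrow> weight G {u, v} < 2 ^ k"
  shows "rep k x \<in> S \<longleftrightarrow> x \<in> S"
proof -
  have "(x, y) \<in> heavy k \<Longrightarrow> x \<in> S \<longleftrightarrow> y \<in> S" for y
    unfolding heavy_def
  proof (induction rule: rtrancl_induct)
    case (step y z)
    then have yz: "{y, z} \<in> edges G" "2 ^ k \<le> weight G {y, z}" by auto
    have "\<not> (y \<in> S \<and> z \<notin> S)" "\<not> (z \<in> S \<and> y \<notin> S)"
      using assms[of y z] assms[of z y] yz by (auto simp: crossing_def insert_commute)
    then show ?case using step.IH by blast
  qed simp
  then show ?thesis using rep_heavy by blast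
qed

text \<open>Rounding down to multiples of \<open>2 ^ M / 2 ^ (3 * L)\<close> gives integers, which
  can be stored exactly, and drops the edges below that unit.\<close>

definition quant :: "nat \<Rightarrow> nat set \<Rightarrow> nat" where
  "quant M e = nat \<lfloor>weight G e * 2 ^ (3 * L) / 2 ^ M\<rfloor>"

text \<open>The threshold is \<open>M + 1\<close> because level \<open>M\<close> serves queries
  whose heaviest cut edge has weight in \<open>[2 ^ M, 2 ^ (M + 1))\<close>: that edge must survive,
  while anything heavier may be contracted.\<close>

definition merged :: "nat \<Rightarrow> nat \<Rightarrow> nat \<Rightarrow> (nat \<times> nat) set" where
  "merged M x y = {(u, v). {u, v} \<in> edges G \<and> rep (M + 1) u = x \<and> rep (M + 1) v = y}"

definition lweight :: "nat \<Rightarrow> nat \<Rightarrow> nat \<Rightarrow> nat" where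
  "lweight M x y = (if x = y then 0 else \<Sum>(u, v)\<in>merged M x y. quant M {u, v})"

definition active :: "nat \<Rightarrow> nat set" where
  "active M = {x. \<exists>y. 0 < lweight M x y}"

lemma merged_subset: "merged M x y \<subseteq> {..<n} \<times> {..<n}"
  using edgeD by (auto simp: merged_def)

lemma lweight_sym: "lweight M x y = lweight M y x"
proof -
  have "(\<Sum>(u, v)\<in>merged M x y. quant M {u, v}) = (\<Sum>(u, v)\<in>prod.swap ` merged M x y. quant M {u, v})"
    by (subst sum.reindex) (auto simp: inj_on_def insert_commute intro!: sum.cong)
  also have "prod.swap ` merged M x y = merged M y x"
    by (force simp: merged_def insert_commute)
  finally show ?thesis by (simp add: lweight_def)
qed

lemma lweight_posE:
  assumes "0 < lweight M x y"
  obtains u v where "x \<noteq> y" "{u, v} \<in> edges G" "rep (M + 1) u = x" "rep (M + 1) v = y" "0 < quant M {u, v}"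
proof -
  have "x \<noteq> y" "(\<Sum>(u, v)\<in>merged M x y. quant M {u, v}) \<noteq> 0"
    using assms by (auto simp: lweight_def split: if_splits)
  then obtain z where "z \<in> merged M x y" "(case z of (u, v) \<Rightarrow> quant M {u, v}) \<noteq> 0"
    using sum.neutral by (metis (no_types, lifting))
  then show ?thesis
    using \<open>x \<noteq> y\<close> that by (auto simp: merged_def)
qed

lemma active_less: "x \<in> active M \<Longrightarrow> x < n"
proof -
  assume "x \<in> active M"
  then obtain y where "0 < lweight M x y" by (auto simp: active_def)
  then obtain u v where "{u, v} \<in> edges G" "rep (M + 1) u = x" by (rule lweight_posE)
  then show "x < n" using edgeD(1)[of u v] rep_le[of "M + 1" u] by auto
qed

lemma finite_active: "finite (active M)" and card_active_le: "card (active M) \<le> n"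
proof -
  have sub: "active M \<subseteq> {..<n}" using active_less by auto
  then show "finite (active M)" by (rule finite_subset) simp
  show "card (active M) \<le> n" using card_mono[OF _ sub] by simp
qed

lemma lweight_active: "0 < lweight M x y \<Longrightarrow> x \<in> active M \<and> y \<in> active M"
  by (metis (mono_tags, lifting) active_def lweight_sym mem_Collect_eq)

lemma quant_le: "weight G e < 2 ^ (M + 1) \<Longrightarrow> quant M e \<le> 2 ^ (3 * L + 1)"
proof -
  assume "weight G e < 2 ^ (M + 1)"
  then have "weight G e * 2 ^ (3 * L) / 2 ^ M \<le> 2 ^ (M + 1) * 2 ^ (3 * L) / 2 ^ M"
    by (intro divide_right_mono mult_right_mono) auto
  also have "\<dots> = real (2 ^ (3 * L + 1))" by simp
  finally have "real (quant M e) \<le> real (2 ^ (3 * L + 1))"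
    unfolding quant_def by linarith
  then show ?thesis by (simp only: of_nat_le_iff)
qed

lemma quant_ge_1: "2 ^ M \<le> weight G e \<Longrightarrow> 1 \<le> quant M e"
proof -
  assume w: "2 ^ M \<le> weight G e"
  then have "0 \<le> weight G e" by (rule order_trans[rotated]) simp
  with w have "2 ^ M * 1 \<le> weight G e * 2 ^ (3 * L)"
    by (intro mult_mono) auto
  then have "1 \<le> \<lfloor>weight G e * 2 ^ (3 * L) / 2 ^ M\<rfloor>" by (simp add: le_floor_iff)
  then show ?thesis unfolding quant_def by linarith
qed

lemma lweight_le: "lweight M x y \<le> 2 ^ (5 * L + 1)"
proof (cases "x = y")
  case False
  have "(\<Sum>(u, v)\<in>merged M x y. quant M {u, v}) \<le> (\<Sum>z\<in>merged M x y. 2 ^ (3 * L + 1))"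
  proof (rule sum_mono, clarify)
    fix u v assume uv: "(u, v) \<in> merged M x y"
    then have "weight G {u, v} < 2 ^ (M + 1)"
      using rep_edge[of u v "M + 1"] False by (auto simp: merged_def not_le[symmetric])
    then show "quant M {u, v} \<le> 2 ^ (3 * L + 1)" by (rule quant_le)
  qed
  also have "\<dots> \<le> (n * n) * 2 ^ (3 * L + 1)"
    using card_mono[OF _ merged_subset[of M x y]] by (simp add: card_cartesian_product)
  also have "\<dots> \<le> (2 ^ L * 2 ^ L) * 2 ^ (3 * L + 1)"
    using n_le by (intro mult_mono) auto
  also have "\<dots> = 2 ^ (5 * L + 1)"
    by (simp flip: power_add)
  finally show ?thesis using False by (simp add: lweight_def)
qed (simp add: lweight_def)

text \<open>A positive rounded weight means an edge of weight at least
  \<open>2 ^ M / 2 ^ (3 * L)\<close>, so contraction at the threshold \<open>M - 3 * L\<close>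
  merges its ends.\<close>

lemma active_merges:
  assumes "x \<in> active M"
  shows "rep (M + 1) x = x" "\<exists>y\<in>active M. y \<noteq> x \<and> rep (M - 3 * L) y = rep (M - 3 * L) x"
proof -
  obtain y where y: "0 < lweight M x y" using assms by (auto simp: active_def)
  then obtain u v where uv: "x \<noteq> y" "{u, v} \<in> edges G" "rep (M + 1) u = x" "rep (M + 1) v = y" "0 < quant M {u, v}"
    by (rule lweight_posE)
  show "rep (M + 1) x = x" using uv(3) rep_rep[of "M + 1" "M + 1" u] by auto
  have "2 ^ (M - 3 * L) \<le> weight G {u, v}"
  \<comment> \<open>If \<open>M < 3 * L\<close>, the truncated exponent is 0, and every edge has
    weight at least 1.\<close>
  proof (cases "M \<ge> 3 * L")
    case True
    have "1 \<le> weight G {u, v} * 2 ^ (3 * L) / 2 ^ M"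
      using uv(5) by (simp add: quant_def le_floor_iff)
    then show ?thesis using True by (simp add: power_diff field_simps)
  qed (use edgeD[OF uv(2)] in auto)
  then have "rep (M - 3 * L) u = rep (M - 3 * L) v" using uv(2) by (intro rep_edge)
  then have "rep (M - 3 * L) y = rep (M - 3 * L) x"
    unfolding uv(3,4)[symmetric] by (simp add: rep_rep)
  then show "\<exists>y\<in>active M. y \<noteq> x \<and> rep (M - 3 * L) y = rep (M - 3 * L) x"
    using lweight_active[OF y] uv(1) by metis
qed

text \<open>The active vertices number at most twice the components that disappear between the
  thresholds \<open>M + 1\<close> and \<open>M - 3 * L\<close>, and these losses telescope. The
  bound is independent of \<open>N\<close>, so \<open>W\<close> affects only the length of a
  key.\<close>

lemma sum_card_active_le: "(\<Sum>M<N. card (active M)) \<le> 2 * (3 * L + 1) * n"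
proof -
  define f where "f k = card (rep k ` {..<n})" for k
  have "mono f"
  proof (rule monoI)
    fix k k' :: nat assume "k \<le> k'"
    then have "rep k ` {..<n} = rep k ` rep k' ` {..<n}" by (auto simp: image_image rep_rep)
    then show "f k \<le> f k'" unfolding f_def by (metis card_image_le finite_imageI finite_lessThan)
  qed
  have f_le: "f k \<le> n" for k
    unfolding f_def using card_image_le[of "{..<n}" "rep k"] by simp
  have "card (active M) \<le> 2 * (f (M + 1) - f (M - 3 * L))" for M
  proof -
    have "card (active M) \<le> 2 * (card (rep (M + 1) ` {..<n}) - card (rep (M - 3 * L) ` rep (M + 1) ` {..<n}))"
    proof (rule card_merged_le)
      show "active M \<subseteq> rep (M + 1) ` {..<n}"
        using active_merges(1) active_less by (metis imageI lessThan_iff subsetI)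
    qed (use active_merges(2) in auto)
    also have "rep (M - 3 * L) ` rep (M + 1) ` {..<n} = rep (M - 3 * L) ` {..<n}"
      by (auto simp: image_image rep_rep)
    finally show ?thesis by (simp add: f_def)
  qed
  then have "(\<Sum>M<N. card (active M)) \<le> (\<Sum>M<N. 2 * (f (M + 1) - f (M - 3 * L)))"
    by (intro sum_mono)
  also have "\<dots> \<le> 2 * ((3 * L + 1) * n)"
    using telescope_bounded[OF \<open>mono f\<close> f_le, where N = N and c = "3 * L"] by (simp flip: sum_distrib_left)
  finally show ?thesis by simp
qed

definition level_cut :: "nat \<Rightarrow> nat set \<Rightarrow> nat" where
  "level_cut M S = (\<Sum>x\<in>active M \<inter> S. \<Sum>y\<in>active M - S. lweight M x y)"

text \<open>No cut edge is contracted, so merged ends keep their sides and the cut edges can be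
  grouped by merged pair.\<close>

lemma level_cut_crossing:
  assumes "\<And>u v. (u, v) \<in> crossing S \<Longrightarrow> weight G {u, v} < 2 ^ (M + 1)"
  shows "level_cut M S = (\<Sum>(u, v)\<in>crossing S. quant M {u, v})"
proof -
  have side: "rep (M + 1) x \<in> S \<longleftrightarrow> x \<in> S" for x
    using assms by (rule rep_same_side)
  let ?T = "({..<n} \<inter> S) \<times> ({..<n} - S)"
  have "(\<Sum>(u, v)\<in>crossing S. quant M {u, v})
     = (\<Sum>p\<in>?T. \<Sum>z\<in>{z \<in> crossing S. (case z of (u, v) \<Rightarrow> (rep (M + 1) u, rep (M + 1) v)) = p}. case z of (u, v) \<Rightarrow> quant M {u, v})"
  proof (rule sum.group[symmetric])
    show "(\<lambda>(u, v). (rep (M + 1) u, rep (M + 1) v)) ` crossing S \<subseteq> ?T"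
    proof (rule image_subsetI)
      fix z assume "z \<in> crossing S"
      then show "(case z of (u, v) \<Rightarrow> (rep (M + 1) u, rep (M + 1) v)) \<in> ?T"
        using side edgeD le_less_trans[OF rep_le] by (auto simp: crossing_def)
    qed
  qed (auto simp: finite_crossing)
  also have "\<dots> = (\<Sum>(x, y)\<in>?T. lweight M x y)"
  proof (rule sum.cong[OF refl], clarify)
    fix x y assume xy: "x < n" "x \<in> S" "y < n" "y \<notin> S"
    have "{z \<in> crossing S. (case z of (u, v) \<Rightarrow> (rep (M + 1) u, rep (M + 1) v)) = (x, y)} = merged M x y"
      using side xy by (auto simp: crossing_def merged_def)
    moreover have "x \<noteq> y" using xy by auto
    ultimately show "(\<Sum>z\<in>{z \<in> crossing S. (case z of (u, v) \<Rightarrow> (rep (M + 1) u, rep (M + 1) v)) = (x, y)}.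
        case z of (u, v) \<Rightarrow> quant M {u, v}) = lweight M x y"
      by (simp add: lweight_def)
  qed
  also have "\<dots> = (\<Sum>(x, y)\<in>(active M \<inter> S) \<times> (active M - S). lweight M x y)"
    using lweight_active active_less by (intro sum.mono_neutral_right) auto
  also have "\<dots> = level_cut M S"
    by (simp add: level_cut_def sum.cartesian_product)
  finally show ?thesis ..
qed

text \<open>Each cut edge loses at most one rounding unit. There are at most \<open>n * n\<close> of
  them and \<open>n ^ 3 \<le> 2 ^ (3 * L)\<close>, so the loss is at most \<open>2 ^ M / n\<close>,
  while the edge \<open>(u0, v0)\<close> alone weighs at least \<open>2 ^ M\<close>.\<close>

lemma level_cut_approximates:
  assumes "\<And>u v. (u, v) \<in> crossing S \<Longrightarrow> weight G {u, v} < 2 ^ (M + 1)"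
    and big: "(u0, v0) \<in> crossing S" "2 ^ M \<le> weight G {u0, v0}"
  defines "Q \<equiv> 2 ^ M / 2 ^ (3 * L) * real (level_cut M S)"
  shows "Q \<le> cut_weight G S" "cut_weight G S \<le> Q + cut_weight G S / n" "0 < level_cut M S"
proof -
  define s :: real where "s = 2 ^ M / 2 ^ (3 * L)"
  have s: "0 < s" by (simp add: s_def)
  have level: "level_cut M S = (\<Sum>(u, v)\<in>crossing S. quant M {u, v})"
    using assms(1) by (rule level_cut_crossing)
  have Q: "Q = (\<Sum>(u, v)\<in>crossing S. s * quant M {u, v})"
    unfolding Q_def s_def[symmetric] level
    by (simp add: sum_distrib_left case_prod_unfold)
  have quant: "s * quant M e \<le> weight G e" "weight G e \<le> s * quant M e + s" if "0 \<le> weight G e" for e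
  proof -
    have q: "real (quant M e) \<le> weight G e / s" "weight G e / s \<le> real (quant M e) + 1"
      using that s unfolding quant_def s_def by (auto simp: le_nat_iff of_nat_nat)
    then show "s * quant M e \<le> weight G e" "weight G e \<le> s * quant M e + s"
      using s by (auto simp: field_simps)
  qed
  have pos: "0 \<le> weight G {u, v}" if "(u, v) \<in> crossing S" for u v
    using edgeD(4)[of u v] that by (simp add: crossing_def)
  show "Q \<le> cut_weight G S"
    unfolding Q cut_weight_crossing using quant(1) pos by (intro sum_mono) auto
  have "2 ^ M \<le> cut_weight G S"
  proof -
    have "weight G {u0, v0} \<le> cut_weight G S"
      unfolding cut_weight_crossing
      using member_le_sum[OF big(1), of "\<lambda>(u, v). weight G {u, v}"] pos finite_crossing by auto
    then show ?thesis using big(2) by linarith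
  qed
  have "cut_weight G S \<le> (\<Sum>(u, v)\<in>crossing S. s * quant M {u, v} + s)"
    unfolding cut_weight_crossing using quant(2) pos by (intro sum_mono) auto
  also have "\<dots> = Q + card (crossing S) * s"
    by (simp add: Q sum.distrib case_prod_unfold)
  also have "\<dots> \<le> Q + cut_weight G S / n"
  proof -
    have "real (card (crossing S)) * s * n \<le> real (n * n) * s * n"
      using card_crossing_le s by (intro mult_right_mono) (auto simp flip: of_nat_mult)
    also have "\<dots> = s * real (n ^ 3)" by (simp add: power3_eq_cube)
    also have "\<dots> \<le> s * real ((2 ^ L) ^ 3)"
      using n_le s by (intro mult_left_mono of_nat_mono power_mono) auto
    also have "\<dots> = 2 ^ M" by (simp add: s_def mult.commute flip: power_mult)
    also have "\<dots> \<le> cut_weight G S" by fact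
    finally show ?thesis using n_pos by (simp add: field_simps)
  qed
  finally show "cut_weight G S \<le> Q + cut_weight G S / n" .
  have "1 \<le> quant M {u0, v0}" using big(2) by (rule quant_ge_1)
  also have "\<dots> \<le> level_cut M S"
    unfolding level
    using member_le_sum[OF big(1), of "\<lambda>(u, v). quant M {u, v}"] finite_crossing by auto
  finally show "0 < level_cut M S" by simp
qed

text \<open>A test that the decoder can make from the active vertices and their stored
  representatives. It succeeds only where some cut edge has weight at least
  \<open>2 ^ M\<close>.\<close>

definition split_levels :: "nat set \<Rightarrow> nat set" where
  "split_levels S = {M. \<exists>x\<in>active M. (x \<in> S) \<noteq> (rep M x \<in> S)}"

lemma split_levels_crossing:
  assumes "M \<in> split_levels S"
  obtains u v where "(u, v) \<in> crossing S" "2 ^ M \<le> weight G {u, v}"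
proof -
  have "\<exists>u v. (u, v) \<in> crossing S \<and> 2 ^ M \<le> weight G {u, v}"
  proof (rule ccontr)
    assume "\<not> ?thesis"
    then have "weight G {u, v} < 2 ^ M" if "(u, v) \<in> crossing S" for u v
      using that by (meson not_less)
    then have "rep M x \<in> S \<longleftrightarrow> x \<in> S" for x by (rule rep_same_side)
    then show False using assms by (simp add: split_levels_def)
  qed
  then show thesis using that by blast
qed

lemma crossing_le_W: "(u, v) \<in> crossing S \<Longrightarrow> weight G {u, v} \<le> W"
  using edgeD(5)[of u v] by (simp add: crossing_def)

lemma level_le: "2 ^ M \<le> W \<Longrightarrow> M \<le> nat \<lfloor>log 2 W\<rfloor>"
proof -
  assume M: "2 ^ M \<le> W"
  then have "0 < W" by (smt (verit) zero_less_power)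
  then have "real M \<le> log 2 W" using M by (simp add: le_log_iff powr_realpow)
  then show ?thesis by (simp add: le_nat_floor)
qed

text \<open>Only the top matters: the level of the heaviest cut edge passes the test and no higher
  level does, whatever happens below.\<close>

lemma Max_split_levels:
  assumes "crossing S \<noteq> {}"
  defines "M \<equiv> Max (split_levels S)"
  shows "split_levels S \<noteq> {}" "M \<le> nat \<lfloor>log 2 W\<rfloor>"
    "\<And>u v. (u, v) \<in> crossing S \<Longrightarrow> weight G {u, v} < 2 ^ (M + 1)"
    "\<exists>u v. (u, v) \<in> crossing S \<and> 2 ^ M \<le> weight G {u, v}"
proof -
  define P where "P = {M. \<exists>u v. (u, v) \<in> crossing S \<and> 2 ^ M \<le> weight G {u, v}}"
  have P_le: "P \<subseteq> {..nat \<lfloor>log 2 W\<rfloor>}"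
    using crossing_le_W level_le by (fastforce simp: P_def)
  then have finP: "finite P" by (rule finite_subset) simp
  have "0 \<in> P"
  proof -
    obtain u v where "(u, v) \<in> crossing S" using assms(1) by auto
    then show ?thesis using edgeD(4)[of u v] by (auto simp: P_def crossing_def)
  qed
  then have "P \<noteq> {}" by blast
  define K where "K = Max P"
  have K: "K \<in> P" using finP \<open>P \<noteq> {}\<close> by (simp add: K_def)
  have above: "weight G {u, v} < 2 ^ (K + 1)" if "(u, v) \<in> crossing S" for u v
  proof (rule ccontr)
    assume "\<not> ?thesis"
    then have "K + 1 \<in> P" using that by (auto simp: P_def not_less)
    then show False using Max_ge[OF finP] by (fastforce simp: K_def)
  qed
  have sub: "split_levels S \<subseteq> P"
  proof
    fix k assume "k \<in> split_levels S"
    then show "k \<in> P" by (rule split_levels_crossing) (auto simp: P_def)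
  qed
  obtain u v where uv: "(u, v) \<in> crossing S" "2 ^ K \<le> weight G {u, v}" using K by (auto simp: P_def)
  have "K \<in> split_levels S"
  proof -
    let ?x = "rep (K + 1) u" and ?y = "rep (K + 1) v"
    have side: "?x \<in> S" "?y \<notin> S"
      using rep_same_side[of S "K + 1"] above uv(1) by (auto simp: crossing_def)
    have e: "{u, v} \<in> edges G" using uv(1) by (simp add: crossing_def)
    have "0 < lweight K ?x ?y"
    proof -
      have "1 \<le> quant K {u, v}" using uv(2) by (rule quant_ge_1)
      also have "\<dots> \<le> (\<Sum>(u, v)\<in>merged K ?x ?y. quant K {u, v})"
        using member_le_sum[of "(u, v)" "merged K ?x ?y" "\<lambda>(u, v). quant K {u, v}"] e
          finite_subset[OF merged_subset] by (auto simp: merged_def)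
      also have "\<dots> = lweight K ?x ?y" using side by (auto simp: lweight_def)
      finally show ?thesis by simp
    qed
    then have "?x \<in> active K" "?y \<in> active K" using lweight_active by auto
    \<comment> \<open>Both ends share a representative at level \<open>K\<close> but lie on opposite
      sides, so one of them is separated from it by \<open>S\<close>.\<close>
    moreover have "rep K ?x = rep K ?y"
      using rep_edge[OF e uv(2)] by (simp add: rep_rep)
    ultimately have "\<exists>x\<in>active K. (x \<in> S) \<noteq> (rep K x \<in> S)"
      using side by metis
    then show ?thesis by (simp add: split_levels_def)
  qed
  have fin: "finite (split_levels S)" using sub finP by (rule finite_subset)
  have "k \<le> K" if "k \<in> split_levels S" for k
    unfolding K_def by (rule Max_ge[OF finP]) (rule subsetD[OF sub that])
  then have "M = K" unfolding M_def by (rule Max_eqI[OF fin _ \<open>K \<in> split_levels S\<close>])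
  show "split_levels S \<noteq> {}" using \<open>K \<in> split_levels S\<close> by blast
  show "M \<le> nat \<lfloor>log 2 W\<rfloor>" using K P_le \<open>M = K\<close> by auto
  show "\<And>u v. (u, v) \<in> crossing S \<Longrightarrow> weight G {u, v} < 2 ^ (M + 1)"
    using above by (simp only: \<open>M = K\<close>)
  show "\<exists>u v. (u, v) \<in> crossing S \<and> 2 ^ M \<le> weight G {u, v}"
    using uv \<open>M = K\<close> by blast
qed

lemma split_levels_empty: "crossing S = {} \<Longrightarrow> split_levels S = {}"
  using split_levels_crossing by blast

end

section \<open>The sketch\<close>

type_synonym sketch_key = "nat \<times> nat \<times> nat \<times> nat \<times> nat"
type_synonym sketch_val = "nat \<times> nat \<times> nat"

text \<open>A key \<open>(M, b, j, x, y)\<close> stands for the pair \<open>x, y\<close> of vertices of weight level \<open>M\<close>, the class of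
  merged weights in \<open>[2 ^ b, 2 ^ (b + 1))\<close> and the expansion scale \<open>2 ^ (b + j) / \<epsilon>\<close>. Diagonal key_space n L W hold
  the part, the degree within the part and the next-level representative of \<open>x\<close>; the other key_space n L W hold
  the weights of the sampled edges.\<close>

definition key_space :: "nat \<Rightarrow> nat \<Rightarrow> real \<Rightarrow> sketch_key set" where
  "key_space n L W = {..<nat \<lfloor>log 2 W\<rfloor> + 1} \<times> {..<5 * L + 2} \<times> {..<L + 2} \<times> {..<n} \<times> {..<n}"

text \<open>One width for all three fields. The largest is a degree, a sum of at most
  \<open>2 ^ L\<close> weights of at most \<open>2 ^ (5 * L + 1)\<close> each.\<close>

definition val_space :: "nat \<Rightarrow> sketch_val set" where
  "val_space L = {..<2 ^ (6 * L + 2)} \<times> {..<2 ^ (6 * L + 2)} \<times> {..<2 ^ (6 * L + 2)}"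

text \<open>The factors are, in order, the classes, the scales, the rate
  \<open>l / \<epsilon>\<close> for \<open>l = 2 * real L\<close>, the logarithmic factor of the
  decomposition, and the total number of active vertices.\<close>

definition entry_bound :: "nat \<Rightarrow> nat \<Rightarrow> real \<Rightarrow> real" where
  "entry_bound n L \<epsilon> = real (5 * L + 2) * real (L + 2) * (2 * real L / \<epsilon>) * (1 + 2 * real L) *
     real (2 * (3 * L + 1) * n)"

text \<open>One share is for the diagonal entries and three are for the samples, matching the 3 in
  \<open>bernoulli_count_tail\<close>.\<close>

definition max_entries :: "nat \<Rightarrow> nat \<Rightarrow> real \<Rightarrow> nat" where
  "max_entries n L \<epsilon> = nat \<lfloor>4 * entry_bound n L \<epsilon>\<rfloor>"

definition est_vertices :: "(sketch_key \<Rightarrow> sketch_val option) \<Rightarrow> nat \<Rightarrow> nat \<Rightarrow> nat \<Rightarrow> nat set" where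
  "est_vertices F M b j = {x. F (M, b, j, x, x) \<noteq> None}"

definition est_label :: "(sketch_key \<Rightarrow> sketch_val option) \<Rightarrow> nat \<Rightarrow> nat \<Rightarrow> nat \<Rightarrow> nat \<Rightarrow> nat" where
  "est_label F M b j x = fst (the (F (M, b, j, x, x)))"

definition est_scale :: "real \<Rightarrow> (sketch_key \<Rightarrow> sketch_val option) \<Rightarrow> nat set \<Rightarrow> nat \<Rightarrow> nat \<Rightarrow> nat" where
  "est_scale \<epsilon> F S M b = (LEAST j. \<epsilon> * card (smaller_sides (est_vertices F M b j) (est_label F M b j) S) \<le> 1)"

definition est_class :: "real \<Rightarrow> nat \<Rightarrow> (sketch_key \<Rightarrow> sketch_val option) \<Rightarrow> nat set \<Rightarrow> nat \<Rightarrow> nat \<Rightarrow> real" where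
  "est_class \<epsilon> L F S M b = (let j = est_scale \<epsilon> F S M b in
     layer_est (2 * real L) \<epsilon> (2 ^ (b + j)) (est_vertices F M b j) (est_label F M b j)
       (\<lambda>x. real (fst (snd (the (F (M, b, j, x, x))))))
       (\<lambda>x y. if x = y then 0 else case F (M, b, j, x, y) of None \<Rightarrow> 0 | Some v \<Rightarrow> real (fst v)) S)"

text \<open>Vertex data are repeated for every class and scale, so the copy at class 0 and scale 0
  serves for the test.\<close>

definition est_levels :: "(sketch_key \<Rightarrow> sketch_val option) \<Rightarrow> nat set \<Rightarrow> nat set" where
  "est_levels F S = {M. \<exists>x v. F (M, 0, 0, x, x) = Some v \<and> (x \<in> S) \<noteq> (snd (snd v) \<in> S)}"

definition cut_est :: "real \<Rightarrow> nat \<Rightarrow> (sketch_key \<Rightarrow> sketch_val option) \<Rightarrow> nat set \<Rightarrow> real" where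
  "cut_est \<epsilon> L F S = (if est_levels F S = {} then 0 else
     let M = Max (est_levels F S) in 2 ^ M / 2 ^ (3 * L) * (\<Sum>b<5 * L + 2. est_class \<epsilon> L F S M b))"

lemma sum_dyadic_classes:
  fixes w :: nat
  assumes "w < 2 ^ m"
  shows "(\<Sum>b<m. if 2 ^ b \<le> w \<and> w < 2 ^ (b + 1) then w else 0) = w"
proof (cases "w = 0")
  case False
  have "\<exists>k. 2 ^ k \<le> w \<and> w < 2 ^ (k + 1)"
    using ex_power_ivl1[of 2 w] False by auto
  then obtain k where k: "2 ^ k \<le> w" "w < 2 ^ (k + 1)" by blast
  have uniq: "(2 ^ b \<le> w \<and> w < 2 ^ (b + 1)) \<longleftrightarrow> b = k" for b
  proof
    assume b: "2 ^ b \<le> w \<and> w < 2 ^ (b + 1)"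
    then have "(2::nat) ^ b < 2 ^ (k + 1)" "(2::nat) ^ k < 2 ^ (b + 1)" using k by linarith+
    then show "b = k" by (simp add: power_strict_increasing_iff del: power_Suc)
  qed (use k in simp)
  have "(2::nat) ^ k < 2 ^ m" using k(1) assms by linarith
  then have "k < m" by simp
  then show ?thesis by (simp only: uniq) simp
qed simp

lemma sum_nested_Sigma:
  assumes "finite A" "finite B" "finite C" "\<And>a b. finite (D a b)"
  shows "sum f (SIGMA a:A. SIGMA b:B. SIGMA c:C. D a b) = (\<Sum>a\<in>A. \<Sum>b\<in>B. \<Sum>c\<in>C. \<Sum>d\<in>D a b. f (a, b, c, d))"
  using assms by (simp add: sum.Sigma split_def)

lemma card_nested_Sigma:
  assumes "finite A" "finite B" "finite C" "\<And>a. finite (D a)"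
  shows "card (SIGMA a:A. SIGMA b:B. SIGMA c:C. D a) = (\<Sum>a\<in>A. card B * (card C * card (D a)))"
  using assms by simp

lemma sum_nested_const:
  fixes f :: "nat \<Rightarrow> real"
  shows "(\<Sum>a<A. \<Sum>b<B. \<Sum>c<C. k * (f a * d)) = real B * real C * k * d * (\<Sum>a<A. f a)"
  by (simp add: sum_distrib_left algebra_simps)

text \<open>Expansion of more than \<open>1 / \<epsilon>\<close> vertices at
  \<open>\<gamma> / \<epsilon>\<close> gives the cut. It is applied to the scale just below the
  chosen one, which has half its \<open>\<gamma>\<close>; hence the 2 in the assumption
  \<open>heavy\<close> of the variance bound.\<close>

lemma (in sampled_class) scale_heavy:
  assumes "1 < \<epsilon> * card (smaller_sides V lab S)"
  shows "\<gamma> \<le> \<epsilon>\<^sup>2 * cut S"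
proof -
  have "\<gamma> / \<epsilon> * (1 / \<epsilon>) \<le> \<gamma> / \<epsilon> * card (smaller_sides V lab S)"
    using assms \<epsilon> \<gamma>_pos by (intro mult_left_mono) (auto simp: field_simps)
  also have "\<dots> \<le> cut S" by (rule card_smaller_sides_le)
  finally show ?thesis using \<epsilon> by (simp add: field_simps power2_eq_square)
qed

section \<open>The table of a graph and its number of entries\<close>

locale sketched_graph = weighted_graph +
  fixes \<epsilon> :: real
  assumes \<epsilon>_pos: "0 < \<epsilon>" and \<epsilon>_less: "\<epsilon> < 1" and L_pos: "1 \<le> L"
begin

definition class_weight :: "nat \<Rightarrow> nat \<Rightarrow> nat \<Rightarrow> nat \<Rightarrow> nat" where
  "class_weight M b x y =
     (if 2 ^ b \<le> lweight M x y \<and> lweight M x y < 2 ^ (b + 1) then lweight M x y else 0)"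

text \<open>An arbitrary choice is harmless, since the labels are stored in the table and the
  decoder never recomputes them.\<close>

definition label :: "nat \<Rightarrow> nat \<Rightarrow> nat \<Rightarrow> nat \<Rightarrow> nat" where
  "label M b j = (SOME lab. (\<forall>x\<in>active M. lab x \<in> active M) \<and>
    (\<forall>c T. T \<subseteq> {x \<in> active M. lab x = c} \<longrightarrow> 2 * card T \<le> card {x \<in> active M. lab x = c} \<longrightarrow>
      2 ^ (b + j) / \<epsilon> * card T \<le> (\<Sum>x\<in>T. \<Sum>y\<in>{x \<in> active M. lab x = c} - T. real (class_weight M b x y))) \<and>
    (\<Sum>x\<in>active M. \<Sum>y\<in>{y \<in> active M. lab y \<noteq> lab x}. real (class_weight M b x y))
      \<le> 2 * (2 ^ (b + j) / \<epsilon>) * (card (active M) * log 2 (card (active M))))"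

lemma class_weight_sym: "class_weight M b x y = class_weight M b y x"
  unfolding class_weight_def by (simp add: lweight_sym[of M x y])

lemma label:
  shows "x \<in> active M \<Longrightarrow> label M b j x \<in> active M"
    and "T \<subseteq> {x \<in> active M. label M b j x = c} \<Longrightarrow> 2 * card T \<le> card {x \<in> active M. label M b j x = c} \<Longrightarrow>
      2 ^ (b + j) / \<epsilon> * card T
        \<le> (\<Sum>x\<in>T. \<Sum>y\<in>{x \<in> active M. label M b j x = c} - T. real (class_weight M b x y))"
    and "(\<Sum>x\<in>active M. \<Sum>y\<in>{y \<in> active M. label M b j y \<noteq> label M b j x}. real (class_weight M b x y))
      \<le> 2 * (2 ^ (b + j) / \<epsilon>) * (card (active M) * log 2 (card (active M)))"
proof -
  have "0 \<le> 2 ^ (b + j) / \<epsilon>" using \<epsilon>_pos by simp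
  note ex = someI_ex[OF sparse_cut_decomposition[OF finite_active[of M], of "\<lambda>x y. real (class_weight M b x y)", OF _ this],
    folded label_def]
  have sym: "real (class_weight M b x y) = real (class_weight M b y x)" for x y
    by (simp add: class_weight_sym[of M b x y])
  note ex = ex[OF sym]
  show "x \<in> active M \<Longrightarrow> label M b j x \<in> active M" using ex by blast
  show "T \<subseteq> {x \<in> active M. label M b j x = c} \<Longrightarrow> 2 * card T \<le> card {x \<in> active M. label M b j x = c} \<Longrightarrow>
      2 ^ (b + j) / \<epsilon> * card T
        \<le> (\<Sum>x\<in>T. \<Sum>y\<in>{x \<in> active M. label M b j x = c} - T. real (class_weight M b x y))"
    using ex by blast
  show "(\<Sum>x\<in>active M. \<Sum>y\<in>{y \<in> active M. label M b j y \<noteq> label M b j x}. real (class_weight M b x y))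
      \<le> 2 * (2 ^ (b + j) / \<epsilon>) * (card (active M) * log 2 (card (active M)))"
    using ex by blast
qed

lemma sampled_class:
  "sampled_class (active M) (\<lambda>x y. real (class_weight M b x y)) (2 ^ b) (label M b j) (2 ^ (b + j)) \<epsilon> (2 * real L)"
proof unfold_locales
  fix x y
  show "real (class_weight M b x y) = real (class_weight M b y x)"
    by (simp add: class_weight_sym[of M b x y])
  show "real (class_weight M b x y) = 0 \<or>
    2 ^ b \<le> real (class_weight M b x y) \<and> real (class_weight M b x y) < 2 * 2 ^ b"
  proof -
    have "class_weight M b x y = 0 \<or> 2 ^ b \<le> class_weight M b x y \<and> class_weight M b x y < 2 * 2 ^ b"
      by (simp add: class_weight_def)
    then have "real (class_weight M b x y) = 0 \<or>
        real (2 ^ b) \<le> real (class_weight M b x y) \<and> real (class_weight M b x y) < real (2 * 2 ^ b)"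
      by (simp only: of_nat_le_iff of_nat_less_iff of_nat_eq_0_iff)
    then show ?thesis by simp
  qed
next
  show "(2::real) ^ b \<le> 2 ^ (b + j)" by (intro power_increasing) auto
  show "1 \<le> 2 * real L" using L_pos by linarith
next
  fix T c assume "T \<subseteq> {x \<in> active M. label M b j x = c}" "2 * card T \<le> card {x \<in> active M. label M b j x = c}"
  then show "2 ^ (b + j) / \<epsilon> * card T
      \<le> (\<Sum>x\<in>T. \<Sum>y\<in>{x \<in> active M. label M b j x = c} - T. real (class_weight M b x y))"
    by (rule label(2))
qed (use \<epsilon>_pos \<epsilon>_less finite_active in simp_all)

definition levels :: nat where "levels = nat \<lfloor>log 2 W\<rfloor> + 1"

definition class_pairs :: "nat \<Rightarrow> nat \<Rightarrow> (nat \<times> nat) set" where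
  "class_pairs M b = sampled_class.pairs (active M) (\<lambda>x y. real (class_weight M b x y))"

definition class_cut :: "nat \<Rightarrow> nat \<Rightarrow> nat set \<Rightarrow> real" where
  "class_cut M b = weight_class.cut (active M) (\<lambda>x y. real (class_weight M b x y))"

definition class_deg :: "nat \<Rightarrow> nat \<Rightarrow> nat \<Rightarrow> nat \<Rightarrow> nat" where
  "class_deg M b j x = (\<Sum>y\<in>{y \<in> active M. label M b j y = label M b j x}. class_weight M b x y)"

definition samples :: "sketch_key set" where
  "samples = (SIGMA M:{..<levels}. SIGMA b:{..<5 * L + 2}. SIGMA j:{..<L + 2}. class_pairs M b)"

definition class_prob :: "nat \<Rightarrow> nat \<Rightarrow> nat \<Rightarrow> nat \<times> nat \<Rightarrow> real" where
  "class_prob M b j = sampled_class.prob (active M) (\<lambda>x y. real (class_weight M b x y)) (label M b j) (2 ^ (b + j)) \<epsilon> (2 * real L)"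

definition key_prob :: "sketch_key \<Rightarrow> real" where
  "key_prob = (\<lambda>(M, b, j, z). class_prob M b j z)"

definition class_coeff :: "nat \<Rightarrow> nat \<Rightarrow> nat \<Rightarrow> nat set \<Rightarrow> nat \<times> nat \<Rightarrow> real" where
  "class_coeff M b j = sampled_class.coeff (active M) (\<lambda>x y. real (class_weight M b x y)) (label M b j)"

text \<open>Only the off-diagonal entries depend on \<open>\<omega>\<close>; labels, degrees and
  representatives are deterministic.\<close>

definition key_map :: "(sketch_key \<Rightarrow> bool) \<Rightarrow> sketch_key \<Rightarrow> sketch_val option" where
  "key_map \<omega> = (\<lambda>(M, b, j, x, y).
     if M < levels \<and> b < 5 * L + 2 \<and> j < L + 2 then
       (if x = y then (if x \<in> active M then Some (label M b j x, class_deg M b j x, rep M x) else None)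
        else if (x, y) \<in> class_pairs M b \<and> \<omega> (M, b, j, x, y) then Some (class_weight M b x y, 0, 0) else None)
     else None)"

lemma finite_class_pairs: "finite (class_pairs M b)"
  unfolding class_pairs_def by (rule sampled_class.finite_pairs[OF sampled_class, of M b])

lemma class_pairs_iff: "(x, y) \<in> class_pairs M b \<longleftrightarrow> x \<in> active M \<and> y \<in> active M \<and> 0 < class_weight M b x y"
  unfolding class_pairs_def sampled_class.pairs_def[OF sampled_class[of M b 0]] by simp

lemma class_weight_refl: "class_weight M b x x = 0"
  by (simp add: class_weight_def lweight_def)

lemma finite_samples: "finite samples"
  unfolding samples_def by (intro finite_SigmaI finite_class_pairs) auto

lemma sum_samples:
  "(\<Sum>i\<in>samples. f i) = (\<Sum>M<levels. \<Sum>b<5 * L + 2. \<Sum>j<L + 2. \<Sum>z\<in>class_pairs M b. f (M, b, j, z))"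
  unfolding samples_def by (rule sum_nested_Sigma) (auto simp: finite_class_pairs)

lemma key_prob_bounds: "i \<in> samples \<Longrightarrow> 0 < key_prob i \<and> key_prob i \<le> 1"
proof -
  assume i: "i \<in> samples"
  obtain M b j z where i_eq: "i = (M, b, j, z)" by (cases i)
  then have z: "z \<in> class_pairs M b" using i by (simp add: samples_def)
  show ?thesis
    using sampled_class.prob_pos[OF sampled_class[of M b j] z[unfolded class_pairs_def]]
      sampled_class.prob_le_1[OF sampled_class[of M b j], of z]
    by (simp add: i_eq key_prob_def class_prob_def)
qed

lemma sum_class_prob_le: "(\<Sum>z\<in>class_pairs M b. class_prob M b j z) \<le> 2 * L / \<epsilon> * (card (active M) * (1 + 2 * real L))"
proof -
  have "(\<Sum>z\<in>class_pairs M b. class_prob M b j z)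
      \<le> 2 * L / \<epsilon> * (card (active M) * (1 + 2 * log 2 (card (active M))))"
    unfolding class_prob_def class_pairs_def
    using sampled_class.sum_prob_le[OF sampled_class label(3), of M b j] by simp
  also have "\<dots> \<le> 2 * L / \<epsilon> * (card (active M) * (1 + 2 * real L))"
  proof (cases "card (active M) = 0")
    case False
    have "card (active M) \<le> 2 ^ L" using card_active_le[of M] n_le by linarith
    then have "real (card (active M)) \<le> 2 ^ L" using of_nat_mono by fastforce
    then have "log 2 (card (active M)) \<le> L"
      using False by (simp add: log_le_iff powr_realpow)
    then show ?thesis using \<epsilon>_pos by (intro mult_left_mono) auto
  qed simp
  finally show ?thesis .
qed

lemma sum_key_prob_le: "(\<Sum>i\<in>samples. key_prob i) \<le> entry_bound n L \<epsilon>"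
proof -
  have "(\<Sum>i\<in>samples. key_prob i)
      = (\<Sum>M<levels. \<Sum>b<5 * L + 2. \<Sum>j<L + 2. \<Sum>z\<in>class_pairs M b. class_prob M b j z)"
    unfolding sum_samples key_prob_def prod.case ..
  also have "\<dots> \<le> (\<Sum>M<levels. \<Sum>b<5 * L + 2. \<Sum>j<L + 2. 2 * L / \<epsilon> * (card (active M) * (1 + 2 * real L)))"
    by (intro sum_mono sum_class_prob_le)
  also have "\<dots> = real (5 * L + 2) * real (L + 2) * (2 * real L / \<epsilon>) * (1 + 2 * real L) *
      real (\<Sum>M<levels. card (active M))"
    by (simp only: of_nat_sum sum_nested_const)
  also have "\<dots> \<le> real (5 * L + 2) * real (L + 2) * (2 * real L / \<epsilon>) * (1 + 2 * real L) * real (2 * (3 * L + 1) * n)"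
    by (intro mult_left_mono of_nat_mono sum_card_active_le) (use \<epsilon>_pos in simp)
  also have "\<dots> = entry_bound n L \<epsilon>" unfolding entry_bound_def ..
  finally show ?thesis .
qed

definition diagonal :: "sketch_key set" where
  "diagonal = (SIGMA M:{..<levels}. SIGMA b:{..<5 * L + 2}. SIGMA j:{..<L + 2}. (\<lambda>x. (x, x)) ` active M)"

lemma finite_diagonal: "finite diagonal"
  unfolding diagonal_def by (intro finite_SigmaI finite_imageI finite_active) auto

lemma card_diagonal_le: "card diagonal \<le> entry_bound n L \<epsilon>"
proof -
  have "card diagonal = (\<Sum>M<levels. (5 * L + 2) * ((L + 2) * card (active M)))"
    unfolding diagonal_def by (subst card_nested_Sigma) (auto simp: finite_active card_image inj_on_def)
  also have "\<dots> = (5 * L + 2) * (L + 2) * (\<Sum>M<levels. card (active M))"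
    by (simp only: sum_distrib_left mult.assoc)
  also have "\<dots> \<le> (5 * L + 2) * (L + 2) * (2 * (3 * L + 1) * n)"
    by (intro mult_left_mono sum_card_active_le) simp
  finally have "real (card diagonal) \<le> real ((5 * L + 2) * (L + 2) * (2 * (3 * L + 1) * n))"
    by (rule of_nat_mono)
  \<comment> \<open>The remaining factors of \<open>entry_bound\<close> are the sampling costs,
    whose product is at least 1, so the same quantity also bounds the diagonal.\<close>
  also have "\<dots> * 1 \<le> real ((5 * L + 2) * (L + 2) * (2 * (3 * L + 1) * n)) * (2 * real L / \<epsilon> * (1 + 2 * real L))"
  proof (rule mult_left_mono)
    have "1 * 1 \<le> 2 * real L / \<epsilon> * (1 + 2 * real L)"
      using L_pos \<epsilon>_pos \<epsilon>_less by (intro mult_mono) (auto simp: field_simps)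
    then show "1 \<le> 2 * real L / \<epsilon> * (1 + 2 * real L)" by simp
  qed simp
  also have "\<dots> = entry_bound n L \<epsilon>" by (simp only: entry_bound_def of_nat_mult mult_ac)
  finally show ?thesis by simp
qed

lemma dom_key_map: "dom (key_map \<omega>) \<subseteq> diagonal \<union> {i \<in> samples. \<omega> i}"
proof
  fix i assume i: "i \<in> dom (key_map \<omega>)"
  obtain M b j x y where "i = (M, b, j, x, y)" by (cases i)
  then show "i \<in> diagonal \<union> {i \<in> samples. \<omega> i}"
    using i unfolding key_map_def diagonal_def samples_def
    by (cases "x = y") (auto split: if_splits)
qed

lemma card_dom_key_map_le: "card (dom (key_map \<omega>)) \<le> entry_bound n L \<epsilon> + card {i \<in> samples. \<omega> i}"
proof -
  have "finite (diagonal \<union> {i \<in> samples. \<omega> i})"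
    using finite_diagonal finite_samples by simp
  then have "card (dom (key_map \<omega>)) \<le> card (diagonal \<union> {i \<in> samples. \<omega> i})"
    by (rule card_mono[OF _ dom_key_map])
  also have "\<dots> \<le> card diagonal + card {i \<in> samples. \<omega> i}" by (rule card_Un_le)
  finally show ?thesis using card_diagonal_le by linarith
qed

lemma dom_key_map_subset: "dom (key_map \<omega>) \<subseteq> key_space n L W"
proof
  fix i assume i: "i \<in> dom (key_map \<omega>)"
  obtain M b j x y where "i = (M, b, j, x, y)" by (cases i)
  then show "i \<in> key_space n L W"
    using i active_less[of x M] active_less[of y M] unfolding key_map_def key_space_def levels_def
    by (cases "x = y") (auto simp: class_pairs_iff split: if_splits)
qed

lemma class_weight_le: "class_weight M b x y \<le> 2 ^ (5 * L + 1)"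
  using lweight_le[of M x y] by (simp add: class_weight_def)

lemma ran_key_map: "ran (key_map \<omega>) \<subseteq> val_space L"
proof -
  have n: "x < 2 ^ (6 * L + 2)" if "x < n" for x
  proof -
    have "x < 2 ^ L" using that n_le by linarith
    also have "(2::nat) ^ L \<le> 2 ^ (6 * L + 2)" by (intro power_increasing) auto
    finally show ?thesis .
  qed
  have w: "class_weight M b x y < 2 ^ (6 * L + 2)" for M b x y
  proof -
    have "class_weight M b x y \<le> 2 ^ (5 * L + 1)" by (rule class_weight_le)
    also have "(2::nat) ^ (5 * L + 1) < 2 ^ (6 * L + 2)" by (intro power_strict_increasing) auto
    finally show ?thesis .
  qed
  have d: "class_deg M b j x < 2 ^ (6 * L + 2)" for M b j x
  proof -
    have "class_deg M b j x \<le> (\<Sum>y\<in>{y \<in> active M. label M b j y = label M b j x}. 2 ^ (5 * L + 1))"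
      unfolding class_deg_def by (intro sum_mono class_weight_le)
    also have "\<dots> = card {y \<in> active M. label M b j y = label M b j x} * 2 ^ (5 * L + 1)" by simp
    also have "\<dots> \<le> 2 ^ L * 2 ^ (5 * L + 1)"
      using card_mono[OF finite_active[of M], of "{y \<in> active M. label M b j y = label M b j x}"] card_active_le[of M] n_le
      by (intro mult_right_mono) auto
    also have "\<dots> = 2 ^ (6 * L + 1)" by (simp flip: power_add)
    also have "(2::nat) ^ (6 * L + 1) < 2 ^ (6 * L + 2)" by (intro power_strict_increasing) auto
    finally show ?thesis .
  qed
  have "v \<in> val_space L" if "key_map \<omega> (M, b, j, x, y) = Some v" for v M b j x y
  proof -
    have "label M b j x < 2 ^ (6 * L + 2)" "rep M x < 2 ^ (6 * L + 2)" if "x \<in> active M"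
      using n[OF active_less[OF label(1)[OF that]]] n[OF le_less_trans[OF rep_le active_less[OF that]]] by auto
    then show ?thesis
      using that w d by (auto simp: key_map_def val_space_def simp del: power_Suc split: if_splits)
  qed
  then show ?thesis by (auto simp: ran_def)
qed

section \<open>Reading the table\<close>

lemma est_vertices_key_map:
  "M < levels \<Longrightarrow> b < 5 * L + 2 \<Longrightarrow> j < L + 2 \<Longrightarrow> est_vertices (key_map \<omega>) M b j = active M"
  by (auto simp: est_vertices_def key_map_def)

lemma est_label_key_map:
  "M < levels \<Longrightarrow> b < 5 * L + 2 \<Longrightarrow> j < L + 2 \<Longrightarrow> x \<in> active M \<Longrightarrow>
    est_label (key_map \<omega>) M b j x = label M b j x"
  by (simp add: est_label_def key_map_def)

lemma est_levels_key_map: "est_levels (key_map \<omega>) S = split_levels S \<inter> {..<levels}"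
  by (auto simp: est_levels_def split_levels_def key_map_def split: if_splits)

lemma smaller_sides_cong:
  assumes "\<And>x. x \<in> V \<Longrightarrow> lab x = lab' x"
  shows "smaller_sides V lab S = smaller_sides V lab' S"
  unfolding smaller_sides_def by (simp add: assms cong: conj_cong)

lemma est_sides_key_map:
  assumes "M < levels" "b < 5 * L + 2" "j < L + 2"
  shows "smaller_sides (est_vertices (key_map \<omega>) M b j) (est_label (key_map \<omega>) M b j) S
    = smaller_sides (active M) (label M b j) S"
  unfolding est_vertices_key_map[OF assms]
  by (rule smaller_sides_cong) (rule est_label_key_map[OF assms])

text \<open>Scale \<open>L + 1\<close> always qualifies because its threshold exceeds every degree,
  so the least scale exists and is below \<open>L + 2\<close>. If it is positive, the scale below it
  fails and \<open>scale_heavy\<close> applies there.\<close>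

lemma est_scale_key_map:
  fixes S :: "nat set" and \<omega> :: "sketch_key \<Rightarrow> bool"
  assumes M: "M < levels" and b: "b < 5 * L + 2"
  defines "j \<equiv> est_scale \<epsilon> (key_map \<omega>) S M b"
  shows "j < L + 2" "\<epsilon> * card (smaller_sides (active M) (label M b j) S) \<le> 1"
    "(2::real) ^ (b + j) = 2 ^ b \<or> 2 ^ (b + j) \<le> 2 * \<epsilon>\<^sup>2 * class_cut M b S"
proof -
  let ?P = "\<lambda>j. \<epsilon> * card (smaller_sides (est_vertices (key_map \<omega>) M b j) (est_label (key_map \<omega>) M b j) S) \<le> 1"
  have P: "?P i \<longleftrightarrow> \<epsilon> * card (smaller_sides (active M) (label M b i) S) \<le> 1" if "i < L + 2" for i
    using est_sides_key_map[OF M b that] by simp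
  have "smaller_sides (active M) (label M b (L + 1)) S = {}"
  proof (rule decomposed_class.smaller_sides_empty[OF sampled_class.axioms(1)[OF sampled_class[of M b "L + 1"]]])
    have "card (active M) \<le> 2 ^ L" using card_active_le[of M] n_le by linarith
    then have "real (card (active M)) \<le> real (2 ^ L)" by (rule of_nat_mono)
    then have "2 * 2 ^ b * real (card (active M)) \<le> 2 * 2 ^ b * 2 ^ L"
      by (intro mult_left_mono) auto
    also have "\<dots> = 2 ^ (b + (L + 1)) / 1" by (simp add: power_add)
    also have "\<dots> < 2 ^ (b + (L + 1)) / \<epsilon>"
      using \<epsilon>_pos \<epsilon>_less by (intro divide_strict_left_mono) auto
    finally show "2 * 2 ^ b * real (card (active M)) < 2 ^ (b + (L + 1)) / \<epsilon>" .
  qed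
  then have PL: "?P (L + 1)" using P[of "L + 1"] by simp
  have "j \<le> L + 1" unfolding j_def est_scale_def by (rule Least_le) (rule PL)
  then show jL: "j < L + 2" by simp
  have "?P j" unfolding j_def est_scale_def by (rule LeastI) (rule PL)
  then show "\<epsilon> * card (smaller_sides (active M) (label M b j) S) \<le> 1"
    using P[OF jL] by blast
  show "(2::real) ^ (b + j) = 2 ^ b \<or> 2 ^ (b + j) \<le> 2 * \<epsilon>\<^sup>2 * class_cut M b S"
  proof (cases j)
    case (Suc i)
    then have "\<not> ?P i" using not_less_Least[of i ?P] by (simp add: j_def est_scale_def)
    then have "1 < \<epsilon> * card (smaller_sides (active M) (label M b i) S)"
      using P[of i] jL Suc by simp
    from sampled_class.scale_heavy[OF sampled_class this] 
    have "2 ^ (b + i) \<le> \<epsilon>\<^sup>2 * class_cut M b S" by (simp add: class_cut_def)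
    then show ?thesis using Suc by simp
  qed simp
qed

lemma est_class_key_map:
  fixes S :: "nat set" and \<omega> :: "sketch_key \<Rightarrow> bool"
  assumes M: "M < levels" and b: "b < 5 * L + 2"
  defines "j \<equiv> est_scale \<epsilon> (key_map \<omega>) S M b"
  shows "est_class \<epsilon> L (key_map \<omega>) S M b - class_cut M b S
    = (\<Sum>z\<in>class_pairs M b. class_coeff M b j S z * (of_bool (\<omega> (M, b, j, z)) / class_prob M b j z - 1))"
proof -
  have j: "j < L + 2" using est_scale_key_map(1)[OF M b] by (simp add: j_def)
  have deg: "weight_class.deg (active M) (\<lambda>x y. real (class_weight M b x y)) (label M b j) x = real (class_deg M b j x)" for x
    using sampled_class[of M b j]
    by (simp add: weight_class.deg_def[OF decomposed_class.axioms(1)[OF sampled_class.axioms(1)]] class_deg_def)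
  show ?thesis
    unfolding est_class_def Let_def j_def[symmetric] est_vertices_key_map[OF M b j]
      class_cut_def class_pairs_def class_coeff_def class_prob_def
  proof (rule sampled_class.layer_est_error[OF sampled_class])
    fix x assume x: "x \<in> active M"
    show "est_label (key_map \<omega>) M b j x = label M b j x"
      by (rule est_label_key_map[OF M b j x])
    show "real (fst (snd (the (key_map \<omega> (M, b, j, x, x)))))
        = weight_class.deg (active M) (\<lambda>x y. real (class_weight M b x y)) (label M b j) x"
      using M b j x by (simp add: key_map_def deg)
    fix y assume y: "y \<in> active M"
    show "(if x = y then 0 else case key_map \<omega> (M, b, j, x, y) of None \<Rightarrow> 0 | Some v \<Rightarrow> real (fst v)) =
      (if 0 < real (class_weight M b x y) \<and> \<omega> (M, b, j, x, y) then real (class_weight M b x y) else 0)"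
      using M b j x y by (simp add: key_map_def class_pairs_iff class_weight_refl)
  qed
qed

lemma class_cut_eq: "class_cut M b S = (\<Sum>x\<in>active M \<inter> S. \<Sum>y\<in>active M - S. real (class_weight M b x y))"
  unfolding class_cut_def
  using weight_class.cut_def[OF decomposed_class.axioms(1)[OF sampled_class.axioms(1)[OF sampled_class[of M b 0]]]]
  by simp

lemma sum_class_cut: "(\<Sum>b<5 * L + 2. class_cut M b S) = level_cut M S"
proof -
  have "(\<Sum>b<5 * L + 2. class_weight M b x y) = lweight M x y" for x y
  proof -
    have "lweight M x y \<le> 2 ^ (5 * L + 1)" by (rule lweight_le)
    also have "(2::nat) ^ (5 * L + 1) < 2 ^ (5 * L + 2)" by (intro power_strict_increasing) auto
    finally show ?thesis unfolding class_weight_def by (rule sum_dyadic_classes)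
  qed
  then have "real (level_cut M S) = (\<Sum>x\<in>active M \<inter> S. \<Sum>y\<in>active M - S. \<Sum>b<5 * L + 2. real (class_weight M b x y))"
    by (simp only: level_cut_def of_nat_sum flip: of_nat_sum)
  also have "\<dots> = (\<Sum>x\<in>active M \<inter> S. \<Sum>b<5 * L + 2. \<Sum>y\<in>active M - S. real (class_weight M b x y))"
    by (intro sum.cong refl sum.swap)
  also have "\<dots> = (\<Sum>b<5 * L + 2. class_cut M b S)"
    unfolding class_cut_eq by (rule sum.swap)
  finally show ?thesis ..
qed

lemma class_cut_nonneg: "0 \<le> class_cut M b S"
  unfolding class_cut_eq by (intro sum_nonneg) auto

text \<open>The class cuts are non-negative and sum to the level cut. Adding the variances over the
  classes therefore costs no factor in the number of classes.\<close>

lemma sum_squares_class_cut_le: "(\<Sum>b<5 * L + 2. (class_cut M b S)\<^sup>2) \<le> (level_cut M S)\<^sup>2"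
proof -
  have "(\<Sum>b<5 * L + 2. (class_cut M b S)\<^sup>2) \<le> (\<Sum>b<5 * L + 2. class_cut M b S * real (level_cut M S))"
    unfolding power2_eq_square
  proof (intro sum_mono mult_left_mono class_cut_nonneg)
    fix b assume "b \<in> {..<5 * L + 2}"
    then show "class_cut M b S \<le> level_cut M S"
      unfolding sum_class_cut[symmetric] by (intro member_le_sum class_cut_nonneg) auto
  qed
  then show ?thesis
    by (simp only: sum_distrib_right[symmetric] sum_class_cut power2_eq_square of_nat_mult)
qed

text \<open>The scale at which a class is estimated depends on the query, but only through the stored
  partition, not through the samples.\<close>

definition query_scale :: "nat set \<Rightarrow> nat \<Rightarrow> nat \<Rightarrow> nat" where
  "query_scale S M b = est_scale \<epsilon> (key_map (\<lambda>_. False)) S M b"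

lemma est_scale_query: "M < levels \<Longrightarrow> b < 5 * L + 2 \<Longrightarrow> est_scale \<epsilon> (key_map \<omega>) S M b = query_scale S M b"
proof -
  assume M: "M < levels" and b: "b < 5 * L + 2"
  have "est_vertices (key_map \<omega>) M b j = est_vertices (key_map (\<lambda>_. False)) M b j"
    and "est_label (key_map \<omega>) M b j = est_label (key_map (\<lambda>_. False)) M b j" for j
    by (auto simp: est_vertices_def est_label_def key_map_def fun_eq_iff)
  then show ?thesis by (simp add: est_scale_def query_scale_def)
qed

text \<open>Extending the coefficients by zero to the other levels and scales turns the error of one
  query into a sum over the whole independent family, to which Bernstein's inequality applies
  once.\<close>

definition key_coeff :: "nat set \<Rightarrow> nat \<Rightarrow> sketch_key \<Rightarrow> real" where
  "key_coeff S M = (\<lambda>(M', b, j, z). if M' = M \<and> j = query_scale S M b then class_coeff M b j S z else 0)"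

lemma sum_samples_query:
  assumes M: "M < levels" and f: "\<And>i. i \<in> samples \<Longrightarrow> key_coeff S M i = 0 \<Longrightarrow> f i = (0::real)"
  shows "(\<Sum>i\<in>samples. f i) = (\<Sum>b<5 * L + 2. \<Sum>z\<in>class_pairs M b. f (M, b, query_scale S M b, z))"
proof -
  let ?g = "\<lambda>M' b j. if M' = M then if j = query_scale S M b then
    \<Sum>z\<in>class_pairs M b. f (M, b, query_scale S M b, z) else 0 else 0"
  have "(\<Sum>i\<in>samples. f i) = (\<Sum>M'<levels. \<Sum>b<5 * L + 2. \<Sum>j<L + 2. ?g M' b j)"
    unfolding sum_samples
  proof (intro sum.cong refl)
    fix M' b j assume "M' \<in> {..<levels}" "b \<in> {..<5 * L + 2}" "j \<in> {..<L + 2}"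
    then have "f (M', b, j, z) = 0" if "\<not> (M' = M \<and> j = query_scale S M b)" "z \<in> class_pairs M' b" for z
      using that by (intro f) (auto simp: samples_def key_coeff_def)
    then show "(\<Sum>z\<in>class_pairs M' b. f (M', b, j, z)) = ?g M' b j"
      by (cases "M' = M"; cases "j = query_scale S M b") (auto intro!: sum.neutral)
  qed
  also have "\<dots> = (\<Sum>M'<levels. if M' = M then \<Sum>b<5 * L + 2. \<Sum>j<L + 2. if j = query_scale S M b then
      \<Sum>z\<in>class_pairs M b. f (M, b, query_scale S M b, z) else 0 else 0)"
    by (intro sum.cong refl) (simp split: if_split)
  also have "\<dots> = (\<Sum>b<5 * L + 2. \<Sum>j<L + 2. if j = query_scale S M b then
      \<Sum>z\<in>class_pairs M b. f (M, b, query_scale S M b, z) else 0)"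
    using M by (subst sum.delta) auto
  also have "\<dots> = (\<Sum>b<5 * L + 2. \<Sum>z\<in>class_pairs M b. f (M, b, query_scale S M b, z))"
  proof (rule sum.cong[OF refl])
    fix b assume "b \<in> {..<5 * L + 2}"
    then have "query_scale S M b < L + 2"
      using est_scale_key_map(1)[OF M, of b] by (simp add: query_scale_def)
    then show "(\<Sum>j<L + 2. if j = query_scale S M b then
      \<Sum>z\<in>class_pairs M b. f (M, b, query_scale S M b, z) else 0) = (\<Sum>z\<in>class_pairs M b. f (M, b, query_scale S M b, z))"
      by (subst sum.delta) auto
  qed
  finally show ?thesis .
qed

section \<open>Error and success probability of the whole estimate\<close>

lemma est_error:
  assumes M: "M < levels"
  shows "(\<Sum>b<5 * L + 2. est_class \<epsilon> L (key_map \<omega>) S M b) - level_cut M S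
    = (\<Sum>i\<in>samples. key_coeff S M i * (of_bool (\<omega> i) / key_prob i - 1))"
proof -
  have "(\<Sum>b<5 * L + 2. est_class \<epsilon> L (key_map \<omega>) S M b) - level_cut M S
      = (\<Sum>b<5 * L + 2. est_class \<epsilon> L (key_map \<omega>) S M b - class_cut M b S)"
    by (simp only: sum_subtractf sum_class_cut)
  also have "\<dots> = (\<Sum>b<5 * L + 2. \<Sum>z\<in>class_pairs M b.
      key_coeff S M (M, b, query_scale S M b, z) * (of_bool (\<omega> (M, b, query_scale S M b, z)) / key_prob (M, b, query_scale S M b, z) - 1))"
    using est_class_key_map[OF M] est_scale_query[OF M]
    by (intro sum.cong refl) (simp add: key_coeff_def key_prob_def)
  also have "\<dots> = (\<Sum>i\<in>samples. key_coeff S M i * (of_bool (\<omega> i) / key_prob i - 1))"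
    by (rule sum_samples_query[OF M, symmetric]) simp
  finally show ?thesis .
qed

lemma query_scale_props:
  assumes "M < levels" "b < 5 * L + 2"
  shows "\<epsilon> * card (smaller_sides (active M) (label M b (query_scale S M b)) S) \<le> 1"
    "(2::real) ^ (b + query_scale S M b) = 2 ^ b \<or> 2 ^ (b + query_scale S M b) \<le> 2 * \<epsilon>\<^sup>2 * class_cut M b S"
  using est_scale_key_map(2,3)[OF assms] unfolding query_scale_def by auto

lemma key_coeff_le:
  assumes M: "M < levels" and i: "i \<in> samples" "key_prob i < 1"
  shows "2 * L * \<bar>key_coeff S M i\<bar> \<le> 3 * \<epsilon> * level_cut M S * key_prob i"
proof -
  obtain M' b j z where i_eq: "i = (M', b, j, z)" by (cases i)
  have prob: "0 < key_prob i" using key_prob_bounds[OF i(1)] by simp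
  show ?thesis
  proof (cases "M' = M \<and> j = query_scale S M b")
    case True
    then have b: "b < 5 * L + 2" and z: "z \<in> class_pairs M b" using i(1) by (auto simp: i_eq samples_def)
    have "2 * L * \<bar>key_coeff S M i\<bar> \<le> 3 * \<epsilon> * class_cut M b S * key_prob i"
      using sampled_class.coeff_le_prob[OF sampled_class query_scale_props[OF M b, unfolded class_cut_def]
          z[unfolded class_pairs_def]] i(2) True
      by (simp add: i_eq key_coeff_def key_prob_def class_coeff_def class_prob_def class_cut_def)
    also have "\<dots> \<le> 3 * \<epsilon> * level_cut M S * key_prob i"
    proof -
      have "class_cut M b S \<le> level_cut M S"
        unfolding sum_class_cut[symmetric] using b by (intro member_le_sum class_cut_nonneg) auto
      then show ?thesis using prob \<epsilon>_pos by (intro mult_right_mono mult_left_mono) auto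
    qed
    finally show ?thesis .
  next
    case False
    then show ?thesis using prob \<epsilon>_pos by (auto simp: i_eq key_coeff_def)
  qed
qed

lemma key_variance_le:
  assumes M: "M < levels"
  shows "(\<Sum>i\<in>{i \<in> samples. key_prob i < 1}. (key_coeff S M i)\<^sup>2 / key_prob i)
    \<le> 8 * \<epsilon>\<^sup>2 * (level_cut M S)\<^sup>2 / (2 * L)"
proof -
  let ?f = "\<lambda>i. if key_prob i < 1 then (key_coeff S M i)\<^sup>2 / key_prob i else 0"
  have "(\<Sum>i\<in>{i \<in> samples. key_prob i < 1}. (key_coeff S M i)\<^sup>2 / key_prob i) = (\<Sum>i\<in>samples. ?f i)"
    by (rule sum.inter_filter[OF finite_samples])
  also have "\<dots> = (\<Sum>b<5 * L + 2. \<Sum>z\<in>class_pairs M b. ?f (M, b, query_scale S M b, z))"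
    by (rule sum_samples_query[OF M]) simp
  also have "\<dots> \<le> (\<Sum>b<5 * L + 2. 8 * \<epsilon>\<^sup>2 * (class_cut M b S)\<^sup>2 / (2 * L))"
  proof (rule sum_mono)
    fix b assume "b \<in> {..<5 * L + 2}"
    then have b: "b < 5 * L + 2" by simp
    let ?j = "query_scale S M b"
    have "(\<Sum>z\<in>class_pairs M b. ?f (M, b, ?j, z))
        = (\<Sum>z\<in>{z \<in> class_pairs M b. class_prob M b ?j z < 1}. (class_coeff M b ?j S z)\<^sup>2 / class_prob M b ?j z)"
      unfolding sum.inter_filter[OF finite_class_pairs]
      by (intro sum.cong refl) (simp add: key_prob_def key_coeff_def)
    also have "\<dots> \<le> 8 * \<epsilon>\<^sup>2 * (class_cut M b S)\<^sup>2 / (2 * L)"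
      using sampled_class.variance_le[OF sampled_class query_scale_props[OF M b, unfolded class_cut_def]]
      by (simp add: class_pairs_def class_coeff_def class_prob_def class_cut_def)
    finally show "(\<Sum>z\<in>class_pairs M b. ?f (M, b, ?j, z)) \<le> 8 * \<epsilon>\<^sup>2 * (class_cut M b S)\<^sup>2 / (2 * L)" .
  qed
  also have "\<dots> = 8 * \<epsilon>\<^sup>2 / (2 * L) * (\<Sum>b<5 * L + 2. (class_cut M b S)\<^sup>2)"
    unfolding sum_distrib_left by (intro sum.cong) auto
  also have "\<dots> \<le> 8 * \<epsilon>\<^sup>2 / (2 * L) * (level_cut M S)\<^sup>2"
    by (intro mult_left_mono sum_squares_class_cut_le) simp
  finally show ?thesis by simp
qed

text \<open>The size bound is worst case, so a table with too many entries is replaced by the empty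
  one; this event is charged to the failure probability.\<close>

definition sketch_pmf :: "(sketch_key \<Rightarrow> sketch_val option) pmf" where
  "sketch_pmf = map_pmf (\<lambda>\<omega>. if card (dom (key_map \<omega>)) \<le> max_entries n L \<epsilon> then key_map \<omega> else Map.empty)
     (bernoulli_family samples key_prob)"

lemma set_sketch_pmf: "set_pmf sketch_pmf \<subseteq> sparse_maps (key_space n L W) (val_space L) (max_entries n L \<epsilon>)"
proof
  fix F assume "F \<in> set_pmf sketch_pmf"
  then obtain \<omega> where "F = (if card (dom (key_map \<omega>)) \<le> max_entries n L \<epsilon> then key_map \<omega> else Map.empty)"
    unfolding sketch_pmf_def set_map_pmf by (elim imageE) (rule that)
  then show "F \<in> sparse_maps (key_space n L W) (val_space L) (max_entries n L \<epsilon>)"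
    using dom_key_map_subset[of \<omega>] ran_key_map[of \<omega>] by (simp add: sparse_maps_def)
qed

lemma prod_ge_1: "1 \<le> a \<Longrightarrow> 1 \<le> b \<Longrightarrow> (1::real) \<le> a * b"
  using mult_mono[of 1 a 1 b] by simp

lemma entry_bound_ge: "2 * real L \<le> entry_bound n L \<epsilon>"
proof -
  have "1 \<le> real (5 * L + 2) * real (L + 2)" by (intro prod_ge_1) simp_all
  moreover have "1 \<le> (1 + 2 * real L) * real (2 * (3 * L + 1) * n)"
  proof (rule prod_ge_1)
    have "1 \<le> 2 * (3 * L + 1) * n" using n_pos by simp
    then show "1 \<le> real (2 * (3 * L + 1) * n)" by linarith
  qed simp
  ultimately have "1 \<le> real (5 * L + 2) * real (L + 2) * ((1 + 2 * real L) * real (2 * (3 * L + 1) * n))"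
    by (rule prod_ge_1)
  moreover have "2 * real L \<le> 2 * real L / \<epsilon>"
    using \<epsilon>_pos \<epsilon>_less L_pos by (simp add: field_simps)
  ultimately have "2 * real L * 1 \<le> 2 * real L / \<epsilon> * (real (5 * L + 2) * real (L + 2) * ((1 + 2 * real L) * real (2 * (3 * L + 1) * n)))"
    by (intro mult_mono) (use \<epsilon>_pos in auto)
  also have "\<dots> = entry_bound n L \<epsilon>" unfolding entry_bound_def by (simp only: mult_ac)
  finally show ?thesis by simp
qed

text \<open>Both exponents are at least \<open>2 * L\<close> in absolute value, and
  \<open>6 \<le> exp 2\<close> with \<open>3 \<le> 3 ^ L\<close> gives
  \<open>3 * 2 ^ L \<le> exp (2 * L)\<close>.\<close>

lemma failure_prob_le: "2 * exp (- (20 / 9) * real L) + exp (- entry_bound n L \<epsilon>) \<le> 1 / n"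
proof -
  have "(5 / 2 :: real) \<le> exp 1"
    using exp_lower_Taylor_quadratic[of 1] by simp
  then have "(5 / 2)\<^sup>2 \<le> (exp 1 :: real)\<^sup>2" by (intro power_mono) auto
  then have e2: "(6::real) \<le> exp 2"
    by (simp add: power2_eq_square flip: exp_add)
  have "3 * 2 ^ L \<le> (3::real) ^ L * 2 ^ L"
    using power_increasing[of 1 L "3::real"] L_pos by simp
  also have "\<dots> = 6 ^ L" by (simp flip: power_mult_distrib)
  also have "\<dots> \<le> exp 2 ^ L" using e2 by (intro power_mono) auto
  also have "\<dots> = exp (2 * real L)" by (rule exp_of_nat2_mult[symmetric])
  finally have pow: "3 * 2 ^ L \<le> exp (2 * real L)" .
  have "2 * exp (- (20 / 9) * real L) + exp (- entry_bound n L \<epsilon>) \<le> 2 * exp (- (2 * real L)) + exp (- (2 * real L))"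
    using entry_bound_ge by (intro add_mono mult_left_mono) auto
  also have "\<dots> = 3 / exp (2 * real L)" by (simp add: exp_minus field_simps)
  also have "\<dots> \<le> 1 / 2 ^ L" using pow by (simp add: field_simps)
  also have "\<dots> \<le> 1 / n"
  proof -
    have "real n \<le> real (2 ^ L)" using n_le by (rule of_nat_mono)
    then show ?thesis using n_pos by (intro divide_left_mono) auto
  qed
  finally show ?thesis .
qed

text \<open>The 7 is 6 from sampling plus 1 from rounding, whose relative error \<open>1 / n\<close>
  is below \<open>\<epsilon>\<close>.\<close>

lemma cut_est_approximates:
  assumes n: "1 / n < \<epsilon>" and cross: "crossing S \<noteq> {}"
  defines "M \<equiv> Max (split_levels S)"
  assumes err: "\<bar>\<Sum>i\<in>samples. key_coeff S M i * (of_bool (\<omega> i) / key_prob i - 1)\<bar> < 6 * \<epsilon> * level_cut M S"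
  shows "approximates (7 * \<epsilon>) (cut_weight G S) (cut_est \<epsilon> L (key_map \<omega>) S)"
proof -
  note Max = Max_split_levels[OF cross, folded M_def]
  have M: "M < levels" using Max(2) by (simp add: levels_def)
  obtain u v where uv: "(u, v) \<in> crossing S" "2 ^ M \<le> weight G {u, v}" using Max(4) by blast
  have "finite (split_levels S)"
  proof (rule finite_subset)
    show "split_levels S \<subseteq> {..nat \<lfloor>log 2 W\<rfloor>}"
    proof
      fix k assume "k \<in> split_levels S"
      then show "k \<in> {..nat \<lfloor>log 2 W\<rfloor>}"
        by (rule split_levels_crossing) (use crossing_le_W level_le in \<open>fastforce\<close>)
    qed
  qed simp
  then have "split_levels S \<subseteq> {..<levels}"
    using M Max_ge unfolding M_def by (meson lessThan_iff order.strict_trans1 subsetI)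
  then have lev: "est_levels (key_map \<omega>) S = split_levels S"
    by (auto simp: est_levels_key_map)
  define s :: real where "s = 2 ^ M / 2 ^ (3 * L)"
  define Q where "Q = s * level_cut M S"
  define X where "X = (\<Sum>i\<in>samples. key_coeff S M i * (of_bool (\<omega> i) / key_prob i - 1))"
  have s: "0 < s" by (simp add: s_def)
  have est: "cut_est \<epsilon> L (key_map \<omega>) S = s * (level_cut M S + X)"
  proof -
    have "(\<Sum>b<5 * L + 2. est_class \<epsilon> L (key_map \<omega>) S M b) = level_cut M S + X"
      using est_error[OF M, of \<omega> S, folded X_def] by linarith
    then show ?thesis
      unfolding cut_est_def lev Let_def M_def[symmetric] s_def[symmetric] if_not_P[OF Max(1)] by (rule arg_cong)
  qed
  have Q: "Q \<le> cut_weight G S" "cut_weight G S \<le> Q + cut_weight G S / n"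
    using level_cut_approximates(1,2)[OF Max(3) uv] by (simp_all add: Q_def s_def)
  have C: "0 \<le> cut_weight G S"
    using order_trans[OF _ Q(1)] s by (simp add: Q_def)
  have "\<bar>s * X\<bar> \<le> s * (6 * \<epsilon> * level_cut M S)"
    using err s by (simp add: abs_mult X_def)
  also have "\<dots> = 6 * \<epsilon> * Q" by (simp add: Q_def)
  also have "\<dots> \<le> 6 * \<epsilon> * cut_weight G S" using Q(1) \<epsilon>_pos by (intro mult_left_mono) auto
  finally have sX: "\<bar>s * X\<bar> \<le> 6 * \<epsilon> * cut_weight G S" .
  have "cut_weight G S / n = 1 / n * cut_weight G S" by simp
  also have "\<dots> \<le> \<epsilon> * cut_weight G S" using n C by (intro mult_right_mono) auto
  finally have "cut_weight G S - \<epsilon> * cut_weight G S \<le> Q" using Q(2) by linarith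
  moreover have "0 \<le> \<epsilon> * cut_weight G S" using \<epsilon>_pos C by simp
  ultimately show ?thesis
    using sX Q(1) by (simp add: approximates_def est distrib_left abs_le_iff Q_def[symmetric] left_diff_distrib distrib_right)
qed

lemma sketch_pmf_approximates:
  assumes n: "1 / n < \<epsilon>"
  shows "1 - 1 / n \<le> measure_pmf.prob sketch_pmf {F. approximates (7 * \<epsilon>) (cut_weight G S) (cut_est \<epsilon> L F S)}"
proof (cases "crossing S = {}")
  case True
  \<comment> \<open>For an empty cut neither the table of the graph nor the empty table shows a
    split level, so the estimate is always exact.\<close>
  then have "cut_est \<epsilon> L F S = 0" if "F \<in> set_pmf sketch_pmf" for F
  proof -
    have "est_levels F S = {}"
      using that split_levels_empty[OF True]
      by (auto simp: sketch_pmf_def est_levels_key_map split: if_splits) (auto simp: est_levels_def)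
    then show ?thesis by (simp add: cut_est_def)
  qed
  moreover have "cut_weight G S = 0" using True by (simp add: cut_weight_crossing)
  ultimately have "measure_pmf.prob sketch_pmf {F. approximates (7 * \<epsilon>) (cut_weight G S) (cut_est \<epsilon> L F S)} = 1"
    by (intro measure_pmf.prob_eq_1[THEN iffD2]) (auto simp: AE_measure_pmf_iff approximates_def)
  then show ?thesis by simp
next
  case False
  let ?M = "Max (split_levels S)" and ?P = "bernoulli_family samples key_prob"
  note Max = Max_split_levels[OF False]
  have M: "?M < levels" using Max(2) by (simp add: levels_def)
  obtain u v where uv: "(u, v) \<in> crossing S" "2 ^ ?M \<le> weight G {u, v}" using Max(4) by blast
  define Q where "Q = real (level_cut ?M S)"
  have Q: "0 < Q" using level_cut_approximates(3)[OF Max(3) uv] by (simp add: Q_def)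
  let ?X = "\<lambda>\<omega>. \<Sum>i\<in>samples. key_coeff S ?M i * (of_bool (\<omega> i) / key_prob i - 1)"
  define B1 where "B1 = {\<omega>. 6 * \<epsilon> * Q \<le> \<bar>?X \<omega>\<bar>}"
  define B2 where "B2 = {\<omega>. 3 * entry_bound n L \<epsilon> \<le> card {i \<in> samples. \<omega> i}}"
  let ?good = "(\<lambda>\<omega>. if card (dom (key_map \<omega>)) \<le> max_entries n L \<epsilon> then key_map \<omega> else Map.empty) -`
    {F. approximates (7 * \<epsilon>) (cut_weight G S) (cut_est \<epsilon> L F S)}"
  \<comment> \<open>The largest value that \<open>key_coeff_le\<close> admits; the exponent then
    becomes \<open>- 4 * L + 16 / 9 * L\<close>.\<close>
  define lam where "lam = 2 * real L / (3 * \<epsilon> * Q)"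
  have lam: "0 < lam" using L_pos \<epsilon>_pos Q by (simp add: lam_def)
  have "measure_pmf.prob ?P B1
      \<le> 2 * exp (- lam * (6 * \<epsilon> * Q) + lam\<^sup>2 * (8 * \<epsilon>\<^sup>2 * Q\<^sup>2 / (2 * L)))"
    unfolding B1_def
  proof (rule bernstein_two_sided[OF finite_samples key_prob_bounds _ lam])
    fix i assume i: "i \<in> samples" "key_prob i < 1"
    have "2 * L * \<bar>key_coeff S ?M i\<bar> \<le> 3 * \<epsilon> * Q * key_prob i"
      using key_coeff_le[OF M i] by (simp add: Q_def)
    then show "lam * \<bar>key_coeff S ?M i\<bar> \<le> key_prob i"
      using \<epsilon>_pos Q by (simp add: lam_def field_simps)
  next
    show "(\<Sum>i | i \<in> samples \<and> key_prob i < 1. (key_coeff S ?M i)\<^sup>2 / key_prob i) \<le> 8 * \<epsilon>\<^sup>2 * Q\<^sup>2 / (2 * L)"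
      using key_variance_le[OF M] by (simp add: Q_def)
  qed
  also have "- lam * (6 * \<epsilon> * Q) + lam\<^sup>2 * (8 * \<epsilon>\<^sup>2 * Q\<^sup>2 / (2 * L)) = - (20 / 9) * real L"
    using \<epsilon>_pos Q L_pos by (simp add: lam_def field_simps power2_eq_square)
  finally have B1: "measure_pmf.prob ?P B1 \<le> 2 * exp (- (20 / 9) * real L)" .
  have B2: "measure_pmf.prob ?P B2 \<le> exp (- entry_bound n L \<epsilon>)"
    unfolding B2_def using key_prob_bounds
    by (intro bernoulli_count_tail finite_samples sum_key_prob_le) (auto simp: less_imp_le)
  \<comment> \<open>Outside \<open>B1\<close> and \<open>B2\<close> the table is not truncated and
    its estimate is accurate.\<close>
  have "UNIV \<subseteq> ?good \<union> (B1 \<union> B2)"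
  proof
    fix \<omega>
    show "\<omega> \<in> ?good \<union> (B1 \<union> B2)"
    proof (cases "\<omega> \<in> B1 \<union> B2")
      case no: False
      have "real (card (dom (key_map \<omega>))) \<le> 4 * entry_bound n L \<epsilon>"
        using no card_dom_key_map_le[of \<omega>] by (auto simp: B2_def)
      then have "card (dom (key_map \<omega>)) \<le> max_entries n L \<epsilon>"
        unfolding max_entries_def by (rule le_nat_floor)
      moreover have "approximates (7 * \<epsilon>) (cut_weight G S) (cut_est \<epsilon> L (key_map \<omega>) S)"
        using no by (intro cut_est_approximates[OF n False]) (auto simp: B1_def Q_def)
      ultimately show ?thesis by simp
    qed simp
  qed
  then have "1 \<le> measure_pmf.prob ?P (?good \<union> (B1 \<union> B2))"
    by (simp add: top.extremum_unique)
  also have "\<dots> \<le> measure_pmf.prob ?P ?good + measure_pmf.prob ?P (B1 \<union> B2)"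
    by (rule measure_Un_le) auto
  also have "measure_pmf.prob ?P (B1 \<union> B2) \<le> measure_pmf.prob ?P B1 + measure_pmf.prob ?P B2"
    by (rule measure_Un_le) auto
  finally have "1 - 1 / n \<le> measure_pmf.prob ?P ?good"
    using B1 B2 failure_prob_le by linarith
  then show ?thesis by (simp add: sketch_pmf_def)
qed

end

section \<open>Size of the sketch\<close>

lemma (in sketched_graph) ex_sketch_pmf:
  assumes "1 / n < \<epsilon>"
  shows "\<exists>D. set_pmf D \<subseteq> sparse_maps (key_space n L W) (val_space L) (max_entries n L \<epsilon>) \<and>
    (\<forall>S. 1 - 1 / n \<le> measure_pmf.prob D {F. approximates (7 * \<epsilon>) (cut_weight G S) (cut_est \<epsilon> L F S)})"
  using set_sketch_pmf sketch_pmf_approximates[OF assms] by blast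

text \<open>The bits of an entry are \<open>h\<close> for the level, \<open>4 * L + 5\<close> for
  class, scale and two vertices, \<open>18 * L + 6\<close> for the value, and one more to absorb
  \<open>Suc\<close>.\<close>

lemma card_key_val_space:
  assumes n: "n \<le> 2 ^ L" and h: "nat \<lfloor>log 2 W\<rfloor> + 1 \<le> 2 ^ h"
  shows "Suc (card (key_space n L W) * card (val_space L)) \<le> 2 ^ (h + 22 * L + 12)"
proof -
  have L: "Suc L \<le> 2 ^ L" by (induction L) auto
  have "card (key_space n L W) * card (val_space L)
      = (nat \<lfloor>log 2 W\<rfloor> + 1) * ((5 * L + 2) * ((L + 2) * (n * n))) * (2 ^ (6 * L + 2) * (2 ^ (6 * L + 2) * 2 ^ (6 * L + 2)))"
    unfolding key_space_def val_space_def card_cartesian_product card_lessThan ..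
  also have "\<dots> \<le> 2 ^ h * (2 ^ (L + 3) * (2 ^ (L + 2) * (2 ^ L * 2 ^ L))) * (2 ^ (6 * L + 2) * (2 ^ (6 * L + 2) * 2 ^ (6 * L + 2)))"
  proof (intro mult_mono h n order_refl)
    show "5 * L + 2 \<le> 2 ^ (L + 3)" using L by (simp add: power_add)
    show "L + 2 \<le> 2 ^ (L + 2)" using L by (simp add: power_add)
  qed auto
  also have "\<dots> = 2 ^ (h + 22 * L + 11)"
    unfolding power_add[symmetric] by (rule arg_cong[of _ _ "(^) 2"]) simp
  finally have "Suc (card (key_space n L W) * card (val_space L)) \<le> Suc (2 ^ (h + 22 * L + 11))" by simp
  also have "\<dots> \<le> 2 * 2 ^ (h + 22 * L + 11)"
  proof -
    have "(1::nat) \<le> 2 ^ (h + 22 * L + 11)" by simp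
    then show ?thesis by linarith
  qed
  also have "\<dots> = 2 ^ (h + 22 * L + 12)"
    by (simp only: power_Suc[symmetric] add_Suc_right[symmetric] Suc_eq_plus1) simp
  finally show ?thesis .
qed

lemma levels_le_power:
  fixes W :: real
  defines "H \<equiv> max 1 (log 2 (log 2 W))"
  assumes W: "1 \<le> W"
  shows "nat \<lfloor>log 2 W\<rfloor> + 1 \<le> 2 ^ nat \<lceil>H + 1\<rceil>"
proof -
  have H: "1 \<le> H" by (simp add: H_def)
  have "log 2 W + 1 \<le> 2 powr (H + 1)"
  \<comment> \<open>For small \<open>W\<close> the bound 4 suffices, as \<open>1 \<le> H\<close>.
    Otherwise adding 1 at most doubles \<open>log 2 W\<close>, which the extra 1 in the exponent
    absorbs.\<close>
  proof (cases "log 2 W \<le> 2")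
    case True
    have "(2::real) powr 2 \<le> 2 powr (H + 1)" using H by (intro powr_mono) auto
    then show ?thesis using True by (simp add: powr_numeral)
  next
    case False
    then have "log 2 W = 2 powr (log 2 (log 2 W))" by simp
    also have "\<dots> \<le> 2 powr H" by (intro powr_mono) (auto simp: H_def)
    finally show ?thesis using False by (simp add: powr_add)
  qed
  also have "2 powr (H + 1) \<le> 2 powr real (nat \<lceil>H + 1\<rceil>)"
    by (intro powr_mono real_nat_ceiling_ge) auto
  also have "\<dots> = 2 ^ nat \<lceil>H + 1\<rceil>" by (simp add: powr_realpow)
  finally have "log 2 W + 1 \<le> real (2 ^ nat \<lceil>H + 1\<rceil>)" by simp
  moreover have "real (nat \<lfloor>log 2 W\<rfloor> + 1) \<le> log 2 W + 1"
    using W by (simp add: of_nat_nat)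
  ultimately have "real (nat \<lfloor>log 2 W\<rfloor> + 1) \<le> real (2 ^ nat \<lceil>H + 1\<rceil>)" by linarith
  then show ?thesis by (simp only: of_nat_le_iff)
qed

lemma max_entries_le:
  assumes "1 \<le> L" "0 < \<epsilon>"
  shows "max_entries n L \<epsilon> \<le> 4032 * real L ^ 5 * (n / \<epsilon>)"
proof -
  define x where "x = real L"
  have x: "1 \<le> x" using assms(1) by (simp add: x_def)
  \<comment> \<open>Each factor is bounded by a multiple of \<open>x\<close> using
    \<open>1 \<le> x\<close>, and \<open>7 * 3 * 2 * 3 * 8 = 1008\<close>.\<close>
  have "entry_bound n L \<epsilon> \<le> (7 * x) * (3 * x) * (2 * x / \<epsilon>) * (3 * x) * (8 * x * n)"
    unfolding entry_bound_def
  proof (intro mult_mono)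
    have "1 * real n \<le> x * real n" using x by (intro mult_right_mono) auto
    then show "real (2 * (3 * L + 1) * n) \<le> 8 * x * real n" by (simp add: x_def algebra_simps)
  qed (use x assms in \<open>auto simp: x_def\<close>)
  also have "\<dots> = 1008 * x ^ 5 * (n / \<epsilon>)"
    by (simp add: power_numeral_reduce field_simps)
  finally have le: "4 * entry_bound n L \<epsilon> \<le> 4032 * x ^ 5 * (n / \<epsilon>)" by simp
  have "0 \<le> 4 * entry_bound n L \<epsilon>"
    using assms by (simp add: entry_bound_def)
  then have "real (max_entries n L \<epsilon>) \<le> 4 * entry_bound n L \<epsilon>"
    unfolding max_entries_def by (rule of_nat_floor)
  with le show ?thesis unfolding x_def by linarith
qed

lemma sketch_bits_le:
  fixes n :: nat and \<epsilon> W :: real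
  defines "L \<equiv> nat \<lceil>log 2 n\<rceil>" and "H \<equiv> max 1 (log 2 (log 2 W))"
  assumes n: "31 \<le> n" and \<epsilon>: "0 < \<epsilon>" "\<epsilon> < 1 / 30"
  shows "(max_entries n L \<epsilon> * (nat \<lceil>H + 1\<rceil> + 22 * L + 12) :: nat) \<le> soft_O 12 (size_param n \<epsilon> W)"
proof -
  have log16: "log 2 (16::real) = 4" using log_of_power_eq[of 16 2 4] by simp
  have "log 2 (16::real) < log 2 n" using n by simp
  then have log_n: "4 < log 2 n" by (simp only: log16)
  then have L: "5 \<le> L" unfolding L_def by linarith
  have L_less: "real L < log 2 n + 1" using log_n unfolding L_def by linarith
  have H: "1 \<le> H" by (simp add: H_def)
  \<comment> \<open>As \<open>1 / \<epsilon> > 30\<close>, the size parameter is at least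
    \<open>16 * n\<close>; the summand 4 in \<open>log 2 (16 * n)\<close> lifts the logarithm above
    \<open>L + 3\<close>.\<close>
  have "16 * real n \<le> real n / \<epsilon>"
    using \<epsilon> n by (simp add: field_simps)
  also have "\<dots> * 1 \<le> real n / \<epsilon> * H"
    using H \<epsilon> by (intro mult_left_mono) auto
  also have "\<dots> = size_param n \<epsilon> W" by (simp add: size_param_def H_def)
  finally have "16 * real n \<le> size_param n \<epsilon> W" by simp
  then have "log 2 (16 * real n) \<le> log 2 (size_param n \<epsilon> W)"
    using n by (intro log_mono) auto
  moreover have "log 2 (16 * real n) = 4 + log 2 n"
    using n by (simp add: log_mult log16)
  ultimately have lg: "real L + 3 \<le> log 2 (size_param n \<epsilon> W)" using L_less by linarith
  have "real (nat \<lceil>H + 1\<rceil> + 22 * L + 12) \<le> (H + 2) + 22 * real L + 12"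
  proof -
    have "real (nat \<lceil>H + 1\<rceil>) \<le> H + 2" using H by linarith
    then show ?thesis by simp
  qed
  \<comment> \<open>The 37 is 1 + 22 + 14.\<close>
  also have "\<dots> \<le> 37 * (H * real L)"
  proof -
    have "1 * real L \<le> H * real L" using H by (intro mult_right_mono) auto
    moreover have "H * 1 \<le> H * real L" using H L by (intro mult_left_mono) auto
    ultimately show ?thesis using L H by linarith
  qed
  finally have t: "real (nat \<lceil>H + 1\<rceil> + 22 * L + 12) \<le> 37 * (H * real L)" .
  have "real (max_entries n L \<epsilon> * (nat \<lceil>H + 1\<rceil> + 22 * L + 12))
      \<le> (4032 * real L ^ 5 * (n / \<epsilon>)) * (37 * (H * real L))"
    unfolding of_nat_mult using L \<epsilon> by (intro mult_mono t max_entries_le) auto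
  also have "\<dots> = size_param n \<epsilon> W * (149184 * real L ^ 6)"
    by (simp add: size_param_def H_def power_numeral_reduce)
  \<comment> \<open>Of the exponent 12, six come from \<open>L ^ 6\<close> and six absorb the
    constant, since \<open>149184 \<le> 8 ^ 6\<close> and \<open>8 \<le> L + 3\<close>.\<close>
  also have "\<dots> \<le> size_param n \<epsilon> W * (8 ^ 6 * real L ^ 6)"
    using \<epsilon> by (intro mult_left_mono mult_right_mono) (auto simp: size_param_def)
  also have "\<dots> \<le> size_param n \<epsilon> W * (log 2 (size_param n \<epsilon> W) ^ 6 * log 2 (size_param n \<epsilon> W) ^ 6)"
    using \<epsilon> lg L by (intro mult_left_mono mult_mono power_mono) (auto simp: size_param_def)
  also have "\<dots> = soft_O 12 (size_param n \<epsilon> W)"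
    by (simp add: soft_O_def flip: power_add)
  finally show ?thesis .
qed

theorem theorem4p12:
  shows "\<exists>(K::real)>0. \<exists>(a::real)\<ge>1. \<exists>c::nat.
    \<forall>(n::nat) (\<epsilon>::real) (W::real).
      1 \<le> n \<longrightarrow> 1 / real n < \<epsilon> \<longrightarrow> \<epsilon> < 1 / 30 \<longrightarrow> 1 \<le> W \<longrightarrow>
      (\<exists>(sk :: wgraph \<Rightarrow> bool list pmf) (est :: bool list \<Rightarrow> nat set \<Rightarrow> real).
         sketch_size_le n W sk (soft_O c (size_param n \<epsilon> W)) \<and>
         for_each_cut_sketch n W (K * \<epsilon>) (1 - 1 / real n powr a) sk est)"
proof (rule exI[of _ 7], rule conjI, simp, rule exI[of _ 1], rule conjI, simp, rule exI[of _ 12], intro allI impI)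
  \<comment> \<open>The constants are the error factor 7 from sampling and rounding, the exponent 1
    from the failure probability \<open>1 / n\<close>, and the power 12 from
    \<open>sketch_bits_le\<close>.\<close>
  fix n :: nat and \<epsilon> W :: real
  assume n: "1 \<le> n" and \<epsilon>: "1 / real n < \<epsilon>" "\<epsilon> < 1 / 30" and W: "1 \<le> W"
  define L where "L = nat \<lceil>log 2 n\<rceil>"
  define h where "h = nat \<lceil>max 1 (log 2 (log 2 W)) + 1\<rceil>"
  define N where "N = max_entries n L \<epsilon> * (h + 22 * L + 12)"
  let ?X = "sparse_maps (key_space n L W) (val_space L) (max_entries n L \<epsilon>)"
  have \<epsilon>_pos: "0 < \<epsilon>" using \<epsilon>(1) by (rule le_less_trans[rotated]) simp
  \<comment> \<open>The two bounds on \<open>\<epsilon>\<close> together force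
    \<open>n > 30\<close>.\<close>
  have "1 / real n < 1 / 30" using \<epsilon> by linarith
  then have "30 < real n" using n by (simp add: field_simps)
  then have n31: "31 \<le> n" by simp
  have n_le: "n \<le> 2 ^ L"
  proof -
    have "log 2 n \<le> real L" unfolding L_def by (rule real_nat_ceiling_ge)
    then have "2 powr log 2 n \<le> 2 powr real L" by (intro powr_mono) auto
    then have "real n \<le> real (2 ^ L)" using n by (simp add: powr_realpow)
    then show ?thesis by (simp only: of_nat_le_iff)
  qed
  have L: "1 \<le> L"
    using n_le n31 by (cases L) auto
  have fin: "finite (key_space n L W)" "finite (val_space L)"
    by (simp_all add: key_space_def val_space_def)
  have "card ?X \<le> Suc (card (key_space n L W) * card (val_space L)) ^ max_entries n L \<epsilon>"
    by (rule sparse_maps_finite_card(2)[OF fin])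
  also have "\<dots> \<le> (2 ^ (h + 22 * L + 12)) ^ max_entries n L \<epsilon>"
    by (rule power_mono[OF card_key_val_space[OF n_le levels_le_power[OF W, folded h_def]]]) simp
  also have "\<dots> = 2 ^ N" by (simp add: N_def mult.commute flip: power_mult)
  finally obtain enc :: "_ \<Rightarrow> bool list" and dec
    where enc: "\<And>F. F \<in> ?X \<Longrightarrow> length (enc F) = N" "\<And>F. F \<in> ?X \<Longrightarrow> dec (enc F) = F"
    using ex_fixed_length_encoding[OF sparse_maps_finite_card(1)[OF fin]] by blast
  have "\<exists>D. set_pmf D \<subseteq> ?X \<and> (\<forall>S. 1 - 1 / n \<le>
      measure_pmf.prob D {F. approximates (7 * \<epsilon>) (cut_weight G S) (cut_est \<epsilon> L F S)})"
    if "G \<in> wgraphs n W" for G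
  proof -
    interpret sketched_graph n L W G \<epsilon>
      by unfold_locales (use that n n_le \<epsilon>_pos \<epsilon>(2) L in auto)
    show ?thesis by (rule ex_sketch_pmf[OF \<epsilon>(1)])
  qed
  then obtain D where D: "\<And>G. G \<in> wgraphs n W \<Longrightarrow> set_pmf (D G) \<subseteq> ?X"
      "\<And>G S. G \<in> wgraphs n W \<Longrightarrow> 1 - 1 / n \<le>
        measure_pmf.prob (D G) {F. approximates (7 * \<epsilon>) (cut_weight G S) (cut_est \<epsilon> L F S)}"
    by metis
  show "\<exists>sk est. sketch_size_le n W sk (soft_O 12 (size_param n \<epsilon> W)) \<and>
      for_each_cut_sketch n W (7 * \<epsilon>) (1 - 1 / real n powr 1) sk est"
  proof (intro exI conjI)
    \<comment> \<open>Only \<open>?sk\<close> depends on the graph; \<open>?est\<close> uses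
      \<open>dec\<close>, \<open>\<epsilon>\<close> and \<open>L\<close>, which are fixed before the
      graph is chosen.\<close>
    let ?sk = "\<lambda>G. map_pmf enc (D G)" and ?est = "\<lambda>b. cut_est \<epsilon> L (dec b)"
    have "real N \<le> soft_O 12 (size_param n \<epsilon> W)"
      unfolding N_def h_def L_def by (rule sketch_bits_le[OF n31 \<epsilon>_pos \<epsilon>(2)])
    then show "sketch_size_le n W ?sk (soft_O 12 (size_param n \<epsilon> W))"
      using D(1) enc(1) by (fastforce simp: sketch_size_le_def)
    show "for_each_cut_sketch n W (7 * \<epsilon>) (1 - 1 / real n powr 1) ?sk ?est"
      unfolding for_each_cut_sketch_def
    proof (intro ballI allI impI)
      fix G S assume G: "G \<in> wgraphs n W"
      let ?A = "\<lambda>f. {F. approximates (7 * \<epsilon>) (cut_weight G S) (cut_est \<epsilon> L (f F) S)}"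
      \<comment> \<open>\<open>dec\<close> is known to invert \<open>enc\<close> on valid tables, so
        the two events are compared on the support of \<open>D G\<close>.\<close>
      have "?A (\<lambda>F. F) \<inter> set_pmf (D G) = ?A (\<lambda>F. dec (enc F)) \<inter> set_pmf (D G)"
        using D(1)[OF G] enc(2) by auto
      then have "measure_pmf.prob (D G) (?A (\<lambda>F. F)) = measure_pmf.prob (D G) (?A (\<lambda>F. dec (enc F)))"
        by (metis measure_Int_set_pmf)
      with D(2)[OF G, of S] n
      show "1 - 1 / real n powr 1 \<le> measure_pmf.prob (?sk G) {b. approximates (7 * \<epsilon>) (cut_weight G S) (?est b S)}"
        by (simp add: vimage_def)
    qed
  qed
qed

end
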